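(* Let $\beta\in(0,1]$ and consider the SAMBA process with learning-rate function $$\alpha(p)=\frac{\beta}{\log(e-\log p)}.$$ Then $(\mathbf p(t))_{t\in\mathbb Z_+}$ is a Markov chain, with probability $1$ we have $p_{a^\star}(t)\to1$ as $t\to\infty$, and for every $T\in\mathbb N$, $$\mathrm{Rg}(T)\le \frac{N}{\beta\Delta}\log T\cdot\log(e+\log T)+Q+1,$$ where $Q:=\sum_{t=0}^\infty\mathbb P\big(p_{a^\star}(t)\le\frac12\big)$.
   Context: Bandit model: $\mathcal A$ is a finite set of arms, $N=|\mathcal A|$. For each arm $a$ and time $t\in\mathbb Z_+=\{0,1,2,\dots\}$, $R_a(t)\in\{0,1\}$ is a Bernoulli random variable with mean $r_a\in[0,1]$; all $R_a(t)$ are independent. There is a unique optimal arm $a^\star$ with $r^\star:=r_{a^\star}>r_a$ for all $a\ne a^\star$, and $\Delta:=r^\star-\max_{a\neq a^\star}r_a>0$. SAMBA process with learning-rate function $\alpha$: $\mathbf p(0)$ is a probability vector on $\mathcal A$ with all entries positive. At each time $t$, let $a_\star(t)$ be an arm maximizing $p_a(t)$ (ties broken uniformly at random) and $p_\star(t)=p_{a_\star(t)}(t)$. Exactly one arm is played at time $t$, arm $a$ with conditional probability $p_a(t)$ given the past (using independent randomization); $I_a(t)$ is the indicator that $a$ is played, $I_\star(t)=I_{a_\star(t)}(t)$, $R_\star(t)=R_{a_\star(t)}(t)$. For each $a\ne a_\star(t)$, $$p_a(t+1)=p_a(t)+\alpha(p_a(t))\,p_a(t)^2\Big[\frac{I_a(t)R_a(t)}{p_a(t)}-\frac{I_\star(t)R_\star(t)}{p_\star(t)}\Big],$$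 and $p_{a_\star(t)}(t+1)=1-\sum_{a\ne a_\star(t)}p_a(t+1)$. Regret: $\mathrm{Rg}(T)=r^\star T-\mathbb E\big[\sum_{t=0}^{T-1}\sum_{a\in\mathcal A}I_a(t)R_a(t)\big]$. *)

theory Defs
  imports "HOL-Probability.Probability"
begin

text \<open>Index set of the driving noise: rewards R_a(t), the uniform variable used to
  select the played arm at time t, and the uniform variable used to break ties
  for the leading arm at time t.\<close>
datatype 'a noise = Rew 'a nat | Sel nat | Tie nat

definition samba_alpha :: "real \<Rightarrow> real \<Rightarrow> real" where
  "samba_alpha \<beta> x = \<beta> / ln (exp 1 - ln x)"

text \<open>Leader a_star(t): an arm maximizing p, chosen uniformly among maximizers
  using a uniform variable v in [0,1).\<close>
definition leader :: "('a::{finite,linorder} \<Rightarrow> real) \<Rightarrow> real \<Rightarrow> 'a" where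
  "leader p v = (let S = {a. p a = Max (range p)}
                 in sorted_list_of_set S ! nat \<lfloor>v * real (card S)\<rfloor>)"

text \<open>Played arm: arm a is chosen with probability p a using a uniform variable u
  (inverse-CDF sampling along the order of arms).\<close>
definition pick :: "('a::{finite,linorder} \<Rightarrow> real) \<Rightarrow> real \<Rightarrow> 'a" where
  "pick p u = (LEAST a. u < (\<Sum>b\<in>{..a}. p b))"

definition samba_step ::
  "(real \<Rightarrow> real) \<Rightarrow> ('a \<Rightarrow> real) \<Rightarrow> 'a \<Rightarrow> 'a \<Rightarrow> ('a \<Rightarrow> real) \<Rightarrow> ('a \<Rightarrow> real)" where
  "samba_step \<alpha> p s i R =
     (let upd = (\<lambda>b. p b + \<alpha> (p b) * (p b)\<^sup>2 *
                    ((if i = b then 1 else 0) * R b / p b - (if i = s then 1 else 0) * R s / p s))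
      in (\<lambda>a. if a = s then 1 - (\<Sum>b\<in>UNIV - {s}. upd b) else upd a))"

primrec samba_proc ::
  "(real \<Rightarrow> real) \<Rightarrow> ('a::{finite,linorder} \<Rightarrow> real) \<Rightarrow> ('a noise \<Rightarrow> 'w \<Rightarrow> real)
     \<Rightarrow> nat \<Rightarrow> 'w \<Rightarrow> ('a \<Rightarrow> real)" where
  "samba_proc \<alpha> p0 X 0 \<omega> = p0"
| "samba_proc \<alpha> p0 X (Suc t) \<omega> =
     (let p = samba_proc \<alpha> p0 X t \<omega>
      in samba_step \<alpha> p (leader p (X (Tie t) \<omega>)) (pick p (X (Sel t) \<omega>)) (\<lambda>a. X (Rew a t) \<omega>))"

definition samba_regret ::
  "'w measure \<Rightarrow> ('a::{finite,linorder} noise \<Rightarrow> 'w \<Rightarrow> real) \<Rightarrow> real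
     \<Rightarrow> (nat \<Rightarrow> 'w \<Rightarrow> ('a \<Rightarrow> real)) \<Rightarrow> nat \<Rightarrow> real" where
  "samba_regret M X rstar P T =
     rstar * real T - (\<integral>\<omega>. (\<Sum>t<T. \<Sum>a\<in>UNIV.
        (if pick (P t \<omega>) (X (Sel t) \<omega>) = a then 1 else 0) * X (Rew a t) \<omega>) \<partial>M)"

definition discrete_markov_chain :: "'w measure \<Rightarrow> (nat \<Rightarrow> 'w \<Rightarrow> 's) \<Rightarrow> bool" where
  "discrete_markov_chain M Y \<longleftrightarrow>
     (\<exists>S. countable S \<and> (\<forall>t. \<forall>\<omega>\<in>space M. Y t \<omega> \<in> S)) \<and>
     (\<forall>t x. {\<omega>\<in>space M. Y t \<omega> = x} \<in> sets M) \<and>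
     (\<exists>K. \<forall>t xs. measure M {\<omega>\<in>space M. \<forall>s\<le>Suc t. Y s \<omega> = xs s}
                 = measure M {\<omega>\<in>space M. \<forall>s\<le>t. Y s \<omega> = xs s} * K (xs t) (xs (Suc t)))"

end

theory Submission
  imports Defs
begin

text \<open>
  Given the state \<open>p\<close> and a leader \<open>s\<close>, one step changes \<open>f p\<close> in the mean by a finite sum
  \<open>drift f p s\<close>, so everything reduces to drift inequalities on the open simplex.

  \<^emph>\<open>Convergence.\<close> The coordinate \<open>p\<^sub>\<star>\<close> of the best arm is a bounded submartingale whose drift is bounded
  below away from \<open>p\<^sub>\<star> = 0\<close> and \<open>p\<^sub>\<star> = 1\<close>; by Borel-Cantelli almost every path is eventually trapped
  near one of these two points.  The point 0 is excluded by Fatou's lemma: near it the learning rate is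
  small compared with the gap, so \<open>1 / p\<^sub>\<star>\<close> has negative drift, and correcting it by a multiple of
  \<open>p\<^sub>\<star>\<close> gives a supermartingale, whence \<open>1 / p\<^sub>\<star>\<close> is bounded in mean.

  \<^emph>\<open>Regret.\<close> Let \<open>F' x = 1 / (\<alpha> x * x)\<close> and let \<open>V\<close> be the sum of \<open>F (p a)\<close> over the suboptimal arms.
  As \<open>F\<close> is concave, the drift of \<open>V\<close> plus the instantaneous regret is at most 0 when the best arm leads
  and at most 1 otherwise, hence the regret is bounded by \<open>V (p 0) - E V (p T)\<close> plus the expected time during
  which \<open>p\<^sub>\<star> \<le> 1/2\<close>.  Finally \<open>- F (p a)\<close> is a concave function of \<open>1 / p a\<close>, which grows at most
  linearly in mean once it is truncated from below at \<open>6 N\<close>.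
\<close>

definition open_simplex :: "('a::finite \<Rightarrow> real) set" where
  "open_simplex = {p. (\<forall>a. 0 < p a) \<and> sum p UNIV = 1}"

definition leaders :: "('a::finite \<Rightarrow> real) \<Rightarrow> 'a set" where
  "leaders p = {a. p a = Max (range p)}"

text \<open>The state after arm \<open>i\<close> was played successfully while \<open>s\<close> was the leader.\<close>

definition play :: "real \<Rightarrow> ('a::finite \<Rightarrow> real) \<Rightarrow> 'a \<Rightarrow> 'a \<Rightarrow> 'a \<Rightarrow> real" where
  "play \<beta> p s i = samba_step (samba_alpha \<beta>) p s i (\<lambda>_. 1)"

text \<open>A step without reward leaves the state unchanged, so only successful plays contribute.\<close>

definition drift ::
  "real \<Rightarrow> ('a::finite \<Rightarrow> real) \<Rightarrow> (('a \<Rightarrow> real) \<Rightarrow> real) \<Rightarrow> ('a \<Rightarrow> real) \<Rightarrow> 'a \<Rightarrow> real" where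
  "drift \<beta> r f p s = (\<Sum>i\<in>UNIV. p i * r i * (f (play \<beta> p s i) - f p))"

section \<open>The learning rate\<close>

lemma one_le_ln_e_minus_ln:
  assumes "0 < x" "x \<le> 1"
  shows "1 \<le> ln (exp 1 - ln x :: real)"
proof -
  have "ln x \<le> 0" using assms by simp
  then have "ln (exp 1) \<le> ln (exp 1 - ln x)"
    by (subst ln_le_cancel_iff) (use exp_gt_zero[of "1::real"] in linarith)+
  then show ?thesis by simp
qed

lemma samba_alpha_pos: "0 < \<beta> \<Longrightarrow> 0 < x \<Longrightarrow> x \<le> 1 \<Longrightarrow> 0 < samba_alpha \<beta> x"
  using one_le_ln_e_minus_ln[of x] by (simp add: samba_alpha_def)

lemma samba_alpha_mono:
  assumes "0 < \<beta>" "0 < x" "x \<le> y" "y \<le> 1"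
  shows "samba_alpha \<beta> x \<le> samba_alpha \<beta> y"
proof -
  have ly: "ln y \<le> 0" using assms by simp
  have "ln x \<le> ln y" using assms by simp
  then have "ln (exp 1 - ln y) \<le> ln (exp 1 - ln x)"
    using ly exp_gt_zero[of "1::real"] by (subst ln_le_cancel_iff) linarith+
  moreover have "1 \<le> ln (exp 1 - ln y)" using assms one_le_ln_e_minus_ln[of y] by simp
  ultimately show ?thesis
    using assms unfolding samba_alpha_def by (intro divide_left_mono) auto
qed

text \<open>By monotonicity only x = 1/2 matters, where exp (6/5) \<le> e + ln 2 is enough. A rate
  of at most 5/6 leaves a losing arm at least a sixth of its probability.\<close>

lemma samba_alpha_le_five_sixths:
  assumes "0 < \<beta>" "\<beta> \<le> 1" "0 < x" "x \<le> 1/2"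
  shows "samba_alpha \<beta> x \<le> 5/6"
proof -
  have "exp (6/5) = exp 1 * exp (1/5 :: real)" by (simp flip: exp_add)
  \<comment> \<open>31/25 = 1 + 1/5 + (1/5)^2; the surplus e * 6/25 is then below 2/3 \<le> ln
    2.\<close>
  also have "\<dots> \<le> exp 1 * (31/25)"
    using exp_bound[of "1/5"] by (intro mult_left_mono) (auto simp: power2_eq_square)
  also have "\<dots> \<le> exp 1 + ln 2" using e_less_272 ln2_ge_two_thirds by simp
  finally have "6/5 \<le> ln (exp 1 + ln 2 :: real)"
    by (subst ln_ge_iff) (auto intro: add_pos_pos)
  then have "samba_alpha \<beta> (1/2) \<le> 1 / (6/5)"
    using assms unfolding samba_alpha_def by (intro frac_le) (auto simp: ln_div)
  then show ?thesis using samba_alpha_mono[of \<beta> x "1/2"] assms by auto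
qed

section \<open>One step of the process\<close>

lemma open_simplexD:
  assumes "p \<in> open_simplex"
  shows "0 < p a" "p a \<le> 1" "sum p UNIV = 1"
proof -
  show 1: "0 < p a" "sum p UNIV = 1" for a using assms by (auto simp: open_simplex_def)
  have "p a \<le> sum p UNIV" using 1 by (intro member_le_sum) (auto intro: less_imp_le)
  then show "p a \<le> 1" using 1 by simp
qed

lemma leadersD:
  assumes "s \<in> leaders p"
  shows "p a \<le> p s"
  using assms by (auto simp: leaders_def)

lemma leader_ge:
  fixes p :: "'a::finite \<Rightarrow> real"
  assumes "p \<in> open_simplex" "s \<in> leaders p"
  shows "1 \<le> real CARD('a) * p s"
proof -
  have "sum p UNIV \<le> (\<Sum>a\<in>(UNIV::'a set). p s)" using leadersD[OF assms(2)] by (intro sum_mono) auto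
  then show ?thesis using open_simplexD(3)[OF assms(1)] by simp
qed

lemma not_leader_le_half:
  assumes "p \<in> open_simplex" "s \<in> leaders p" "a \<noteq> s"
  shows "p a \<le> 1/2"
proof -
  have "p a + p s = sum p {a, s}" using assms by simp
  also have "\<dots> \<le> sum p UNIV" using open_simplexD(1)[OF assms(1)] by (intro sum_mono2) (auto intro: less_imp_le)
  finally show ?thesis using open_simplexD(3)[OF assms(1)] leadersD[OF assms(2), of a] by simp
qed

text \<open>All increments vanish, and the leader, defined as the complement of the rest, is
  restored because \<open>p\<close> sums to 1.\<close>

lemma samba_step_no_reward:
  fixes p :: "'a::finite \<Rightarrow> real"
  assumes "sum p UNIV = 1" "R i = 0"
  shows "samba_step \<alpha> p s i R = p"
proof -
  have *: "(if i = b then 1 else 0) * R b = 0" for b using assms by auto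
  have "sum p UNIV = p s + sum p (UNIV - {s})" by (simp add: sum.remove)
  then show ?thesis using assms unfolding samba_step_def Let_def * by auto
qed

lemma samba_step_reward:
  assumes "R i = 1"
  shows "samba_step (samba_alpha \<beta>) p s i R = play \<beta> p s i"
proof -
  have *: "(if i = b then 1 else 0) * R b = (if i = b then 1 else 0) * (1::real)" for b using assms by auto
  show ?thesis unfolding play_def samba_step_def Let_def * ..
qed

text \<open>The leader absorbs whatever the other arms gain or lose.\<close>

lemma sum_play: "sum (play \<beta> p s i) UNIV = 1"
  unfolding play_def samba_step_def Let_def by (subst sum.remove[of _ s]) auto

lemma play_bystander: "a \<noteq> s \<Longrightarrow> a \<noteq> i \<Longrightarrow> i \<noteq> s \<Longrightarrow> play \<beta> p s i a = p a"
  by (simp add: play_def samba_step_def)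

lemma play_challenger:
  "i \<noteq> s \<Longrightarrow> p i \<noteq> 0 \<Longrightarrow> play \<beta> p s i i = p i + samba_alpha \<beta> (p i) * p i"
  by (simp add: play_def samba_step_def power2_eq_square)

lemma play_leader_loses:
  "a \<noteq> s \<Longrightarrow> play \<beta> p s s a = p a - samba_alpha \<beta> (p a) * (p a)\<^sup>2 / p s"
  by (simp add: play_def samba_step_def)

lemma play_challenger_leader:
  assumes "i \<noteq> s" "p i \<noteq> 0" "sum p UNIV = 1"
  shows "play \<beta> p s i s = p s - samba_alpha \<beta> (p i) * p i"
proof -
  have "play \<beta> p s i s = 1 - sum (play \<beta> p s i) (UNIV - {s})"
    using sum_play[of \<beta> p s i] by (simp add: sum.remove[of UNIV s])
  also have "sum (play \<beta> p s i) (UNIV - {s}) = sum p (UNIV - {s}) + (play \<beta> p s i i - p i)"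
  proof -
    have "sum (play \<beta> p s i) (UNIV - {s} - {i}) = sum p (UNIV - {s} - {i})"
      using assms by (intro sum.cong) (auto simp: play_bystander)
    then show ?thesis using assms by (simp add: sum.remove[of "UNIV - {s}" i])
  qed
  also have "sum p (UNIV - {s}) = 1 - p s" using assms(3) by (simp add: sum.remove[of UNIV s])
  finally show ?thesis using play_challenger[of i s p] assms by simp
qed

context
  fixes \<beta> :: real and p :: "'a::finite \<Rightarrow> real" and s :: 'a
  assumes \<beta>: "0 < \<beta>" "\<beta> \<le> 1" and p: "p \<in> open_simplex" and s: "s \<in> leaders p"
begin

lemma alpha_bounds:
  "0 < samba_alpha \<beta> (p a)" "a \<noteq> s \<Longrightarrow> samba_alpha \<beta> (p a) \<le> 5/6"
  using samba_alpha_pos[OF \<beta>(1), of "p a"] samba_alpha_le_five_sixths[OF \<beta>, of "p a"]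
    open_simplexD(1,2)[OF p, of a] not_leader_le_half[OF p s, of a] by auto

text \<open>Since \<open>p a \<le> p s\<close>, the quotient \<open>p a / p s\<close> is at most 1,
  and the relative loss is at most the learning rate.\<close>

lemma play_leader_loses_ge: 
  assumes "a \<noteq> s"
  shows "p a / 6 \<le> play \<beta> p s s a" "play \<beta> p s s a \<le> p a"
proof -
  let ?A = "samba_alpha \<beta> (p a)"
  have pos: "0 < p a" "0 < p s" using open_simplexD[OF p] by auto
  have "?A * (p a * (p a / p s)) \<le> 5/6 * (p a * 1)"
    using alpha_bounds[of a] assms pos leadersD[OF s, of a]
    by (intro mult_mono) (auto simp: divide_le_eq_1)
  then show "p a / 6 \<le> play \<beta> p s s a"
    by (simp add: play_leader_loses[OF assms] power2_eq_square)
  show "play \<beta> p s s a \<le> p a"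
    using alpha_bounds[of a] assms pos by (simp add: play_leader_loses)
qed

lemma play_leader_gains: "p s \<le> play \<beta> p s s s"
proof -
  have "sum (play \<beta> p s s) (UNIV - {s}) \<le> sum p (UNIV - {s})"
    by (intro sum_mono play_leader_loses_ge) auto
  then show ?thesis
    using sum_play[of \<beta> p s s] open_simplexD(3)[OF p] by (simp add: sum.remove[of UNIV s])
qed

text \<open>The challenger gains exactly what the leader pays; as \<open>p i \<le> p s\<close>, this
  is at most 5/6 of either probability.\<close>

lemma play_challenger_bounds:
  assumes "i \<noteq> s"
  shows "p i \<le> play \<beta> p s i i" "play \<beta> p s i i \<le> 2 * p i" "p s / 6 \<le> play \<beta> p s i s" "play \<beta> p s i s \<le> p s"
proof -
  let ?A = "samba_alpha \<beta> (p i)"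
  have pos: "0 < p i" "0 < p s" using open_simplexD[OF p] by auto
  have "?A * p i \<le> 5/6 * p s"
    using alpha_bounds[of i] assms pos leadersD[OF s, of i] by (intro mult_mono) auto
  moreover have "?A * p i \<le> 1 * p i"
    using alpha_bounds[of i] assms pos by (intro mult_right_mono) auto
  moreover have "0 \<le> ?A * p i" using alpha_bounds[of i] pos by auto
  ultimately show "p i \<le> play \<beta> p s i i" "play \<beta> p s i i \<le> 2 * p i"
    "p s / 6 \<le> play \<beta> p s i s" "play \<beta> p s i s \<le> p s"
    using assms pos open_simplexD(3)[OF p] by (auto simp: play_challenger play_challenger_leader)
qed

lemma play_ge: "p a / 6 \<le> play \<beta> p s i a"
proof -
  have "0 < p a" using open_simplexD[OF p] by auto
  then show ?thesis
    using play_leader_loses_ge(1)[of a] play_leader_gains play_challenger_bounds[of i]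
      play_bystander[of a s i \<beta> p]
    by (cases "a = s"; cases "i = s"; cases "a = i") auto
qed

lemma play_in_open_simplex: "play \<beta> p s i \<in> open_simplex"
proof -
  have "0 < play \<beta> p s i a" for a using play_ge[of a i] open_simplexD(1)[OF p, of a] by linarith
  then show ?thesis by (simp add: open_simplex_def sum_play)
qed

text \<open>Non-leaders at most double, and a leader already holds at least 1 / N. This later
  forbids jumps of the best arm from near 0 to near 1.\<close>

lemma play_le_card_mult: "2 \<le> CARD('a) \<Longrightarrow> play \<beta> p s i a \<le> real CARD('a) * p a"
proof -
  assume card: "2 \<le> CARD('a)"
  have pos: "0 < p a" using open_simplexD[OF p] by auto
  have *: "2 * p a \<le> real CARD('a) * p a" using card pos by (intro mult_right_mono) auto
  show ?thesis
  proof (cases "a = s")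
    case True
    then show ?thesis
      using leader_ge[OF p s] open_simplexD(2)[OF play_in_open_simplex, of i a] by simp
  next
    case False
    then have "play \<beta> p s i a \<le> 2 * p a"
      using pos play_leader_loses_ge(2)[of a] play_challenger_bounds(2)[of i] play_bystander[of a s i \<beta> p]
      by (cases "i = s"; cases "a = i") auto
    then show ?thesis using * by linarith
  qed
qed

section \<open>Comparison of drifts and the drift of single coordinates\<close>

lemma drift_mono:
  assumes "\<And>a. 0 \<le> r a" "\<And>i. f (play \<beta> p s i) - f p \<le> c * (g (play \<beta> p s i) - g p)"
  shows "drift \<beta> r f p s \<le> c * drift \<beta> r g p s"
  unfolding drift_def sum_distrib_left
proof (rule sum_mono)
  fix i
  have "p i * r i * (f (play \<beta> p s i) - f p) \<le> p i * r i * (c * (g (play \<beta> p s i) - g p))"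
    using assms open_simplexD(1)[OF p, of i] by (intro mult_left_mono) auto
  then show "p i * r i * (f (play \<beta> p s i) - f p) \<le> c * (p i * r i * (g (play \<beta> p s i) - g p))"
    by (simp add: mult_ac)
qed

text \<open>Meant for functions of \<open>p a\<close> alone: this coordinate moves only when
  \<open>a\<close> or the leader succeeds.\<close>

lemma drift_two_arms:
  assumes "a \<noteq> s" "\<And>i. i \<noteq> a \<Longrightarrow> i \<noteq> s \<Longrightarrow> f (play \<beta> p s i) = f p"
  shows "drift \<beta> r f p s = p a * r a * (f (play \<beta> p s a) - f p) + p s * r s * (f (play \<beta> p s s) - f p)"
proof -
  have "drift \<beta> r f p s = (\<Sum>i\<in>{a, s}. p i * r i * (f (play \<beta> p s i) - f p))"
    unfolding drift_def using assms(2) by (intro sum.mono_neutral_right) auto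
  then show ?thesis using assms(1) by simp
qed

text \<open>Importance weighting cancels the playing probabilities: the successes of
  \<open>a\<close> and of \<open>s\<close> move \<open>p a\<close> by the same mean amount, up to
  the factors \<open>r a\<close> and \<open>- r s\<close>.\<close>

lemma drift_not_leader:
  assumes "a \<noteq> s"
  shows "drift \<beta> r (\<lambda>p. p a) p s = samba_alpha \<beta> (p a) * (p a)\<^sup>2 * (r a - r s)"
proof -
  have pos: "0 < p a" "0 < p s" using open_simplexD[OF p] by auto
  have "drift \<beta> r (\<lambda>p. p a) p s
      = p a * r a * (play \<beta> p s a a - p a) + p s * r s * (play \<beta> p s s a - p a)"
    using assms by (intro drift_two_arms) (auto simp: play_bystander)
  then show ?thesis using pos assms
    by (simp add: play_challenger play_leader_loses field_simps power2_eq_square)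
qed

lemma drift_sum: "drift \<beta> r (\<lambda>p. \<Sum>a\<in>A. f a p) p s = (\<Sum>a\<in>A. drift \<beta> r (f a) p s)"
proof -
  have "drift \<beta> r (\<lambda>p. \<Sum>a\<in>A. f a p) p s
     = (\<Sum>i\<in>UNIV. \<Sum>a\<in>A. p i * r i * (f a (play \<beta> p s i) - f a p))"
    unfolding drift_def by (simp only: sum_subtractf[symmetric] sum_distrib_left)
  also have "\<dots> = (\<Sum>a\<in>A. drift \<beta> r (f a) p s)" unfolding drift_def by (rule sum.swap)
  finally show ?thesis .
qed

text \<open>Total mass is conserved, so the leader's drift is minus the sum of the others.\<close>

lemma drift_leader:
  "drift \<beta> r (\<lambda>p. p s) p s = (\<Sum>b\<in>UNIV-{s}. samba_alpha \<beta> (p b) * (p b)\<^sup>2 * (r s - r b))"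
proof -
  have "drift \<beta> r (\<lambda>p. \<Sum>a\<in>UNIV. p a) p s = 0"
    unfolding drift_def by (simp add: sum_play open_simplexD(3)[OF p])
  then have "drift \<beta> r (\<lambda>p. p s) p s = - (\<Sum>b\<in>UNIV-{s}. drift \<beta> r (\<lambda>p. p b) p s)"
    unfolding drift_sum by (simp add: sum.remove[of UNIV s])
  also have "\<dots> = (\<Sum>b\<in>UNIV-{s}. - (samba_alpha \<beta> (p b) * (p b)\<^sup>2 * (r b - r s)))"
    unfolding sum_negf[symmetric] by (intro sum.cong refl) (simp add: drift_not_leader)
  finally show ?thesis by (simp add: algebra_simps)
qed

end

section \<open>Drift of the reciprocal probabilities\<close>

context
  fixes \<beta> :: real and p :: "'a::finite \<Rightarrow> real" and s :: 'a and r :: "'a \<Rightarrow> real"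
  assumes \<beta>: "0 < \<beta>" "\<beta> \<le> 1" and p: "p \<in> open_simplex" and s: "s \<in> leaders p"
    and r: "\<And>a. 0 \<le> r a" "\<And>a. r a \<le> 1"
begin

text \<open>A leader has probability at least \<open>1 / N\<close> and loses at most the factor 6 in one step,
  so the truncation at \<open>6 N\<close> hides all its losses.\<close>

lemma drift_inverse_leader_le_0:
  assumes K: "6 * real CARD('a) \<le> K"
  shows "drift \<beta> r (\<lambda>p. max (1 / p s) K) p s \<le> 0"
proof -
  have pos: "0 < p s" using open_simplexD[OF p] by auto
  have "max (1 / play \<beta> p s i s) K = K" for i
  proof -
    have "1 / play \<beta> p s i s \<le> 1 / (p s / 6)"
      using play_ge[OF \<beta> p s, of s i] pos by (intro divide_left_mono) auto
    also have "\<dots> \<le> 6 * real CARD('a)"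
      using leader_ge[OF p s] pos by (simp add: field_simps)
    finally show ?thesis using K by simp
  qed
  then have "drift \<beta> r (\<lambda>p. max (1 / p s) K) p s \<le> 0 * drift \<beta> r (\<lambda>_. 0) p s"
    using r by (intro drift_mono[OF \<beta> p s]) auto
  then show ?thesis by simp
qed

text \<open>A rise of at most \<open>1 / p s\<close> is what the probability \<open>p s\<close> of a
  leader's play compensates. With z = p s / p a the claim becomes z^2 \<le> (m + 1) (z - A); near z
  = 1 this relies on the truncation, which makes m large.\<close>

lemma max_inverse_play_leader_le:
  assumes K: "6 * real CARD('a) \<le> K" and a: "a \<noteq> s"
  shows "max (1 / play \<beta> p s s a) K \<le> max (1 / p a) K + 1 / p s"
proof -
  let ?A = "samba_alpha \<beta> (p a)" and ?q = "play \<beta> p s s a"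
  have pos: "0 < p a" "0 < p s" "0 < ?q"
    using open_simplexD(1)[OF p] open_simplexD(1)[OF play_in_open_simplex[OF \<beta> p s]] by auto
  \<comment> \<open>In units of \<open>1 / p s\<close>, \<open>z\<close> is the reciprocal
    \<open>1 / p a\<close> and \<open>m\<close> its truncation at \<open>K\<close>.\<close>
  define z where "z = p s / p a"
  define m where "m = max z (K * p s)"
  have "6 * (real CARD('a) * p s) \<le> K * p s"
    using mult_right_mono[OF K, of "p s"] pos by (simp add: mult_ac)
  then have m: "6 \<le> m" "z \<le> m" using leader_ge[OF p s] by (auto simp: m_def)
  have z: "1 \<le> z" using pos leadersD[OF s, of a] by (simp add: z_def)
  \<comment> \<open>This reads z^2 \<le> (m + 1) z - m, and m \<ge> 5/6 (m + 1) as soon as m \<ge>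
    5.\<close>
  have "(z - 1) * (z - m) \<le> 0" using z m by (intro mult_nonneg_nonpos) auto
  then have "z * z \<le> (m + 1) * (z - 5/6)" using m by (simp add: field_simps)
  also have "\<dots> \<le> (m + 1) * (z - ?A)"
    using m alpha_bounds(2)[OF \<beta> p s a] by (intro mult_left_mono) auto
  finally have *: "z * z \<le> (m + 1) * (z - ?A)" .
  have q: "?q * (z * z) = p s * (z - ?A)"
    unfolding play_leader_loses[OF a] z_def using pos by (simp add: field_simps power2_eq_square)
  have "?q * (z * z) \<le> ?q * ((m + 1) * (z - ?A))" using * pos by (intro mult_left_mono) auto
  then have "p s * (z - ?A) \<le> (?q * (m + 1)) * (z - ?A)" unfolding q by (simp add: mult_ac)
  moreover have "0 < z - ?A" using z alpha_bounds(2)[OF \<beta> p s a] by simp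
  ultimately have "p s \<le> ?q * (m + 1)" by (simp add: mult_le_cancel_right)
  then have "1 / ?q \<le> (m + 1) / p s" using pos by (simp add: field_simps)
  also have "\<dots> = max (1 / p a) K + 1 / p s"
    using pos by (auto simp: m_def z_def max_def field_simps)
  finally show ?thesis using zero_less_divide_1_iff[of "p s"] pos by linarith
qed

lemma drift_inverse_le_1:
  assumes K: "6 * real CARD('a) \<le> K"
  shows "drift \<beta> r (\<lambda>p. max (1 / p a) K) p s \<le> 1"
proof (cases "a = s")
  case True
  then show ?thesis using drift_inverse_leader_le_0[OF K] by simp
next
  case False
  let ?f = "\<lambda>p. max (1 / p a) K"
  have pos: "0 < p a" "0 < p s" using open_simplexD(1)[OF p] by auto
  have "drift \<beta> r ?f p s = p a * r a * (?f (play \<beta> p s a) - ?f p) + p s * r s * (?f (play \<beta> p s s) - ?f p)"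
    using False by (intro drift_two_arms[OF \<beta> p s]) (auto simp: play_bystander)
  also have "p a * r a * (?f (play \<beta> p s a) - ?f p) \<le> 0"
  proof -
    have "1 / play \<beta> p s a a \<le> 1 / p a"
      using play_challenger_bounds(1)[OF \<beta> p s False] pos by (intro divide_left_mono) auto
    then show ?thesis using pos r by (intro mult_nonneg_nonpos) auto
  qed
  also have "p s * r s * (?f (play \<beta> p s s) - ?f p) \<le> p s * 1 * (1 / p s)"
  proof -
    have "1 / p a \<le> 1 / play \<beta> p s s a"
      using play_leader_loses_ge(2)[OF \<beta> p s False] open_simplexD(1)[OF play_in_open_simplex[OF \<beta> p s]] pos
      by (intro divide_left_mono) auto
    then show ?thesis
      using pos r max_inverse_play_leader_le[OF K False] by (intro mult_mono) auto
  qed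
  finally show ?thesis using pos by simp
qed

text \<open>The doubly exponential \<open>K\<close> forces a learning rate A \<le> \<Delta> / 2. The
  reciprocal falls at rate r a A / (1 + A) and rises at rate r s A / (1 - u) with u \<le> A; the gap
  outweighs the second order effect A r s + u r a \<le> 2 A.\<close>

lemma drift_inverse_best_le_0:
  assumes K: "6 * real CARD('a) \<le> K" "exp (exp (2 / \<Delta>)) \<le> K" and \<Delta>: "0 < \<Delta>" "r s \<le> r a - \<Delta>"
    and small: "p a < 1 / (2 * K)" and a: "a \<noteq> s"
  shows "drift \<beta> r (\<lambda>p. max (1 / p a) K) p s \<le> 0"
proof -
  let ?f = "\<lambda>p. max (1 / p a) K" and ?A = "samba_alpha \<beta> (p a)"
  have pos: "0 < p a" "0 < p s" using open_simplexD(1)[OF p] by auto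
  have A: "0 < ?A" "?A \<le> 5/6" using alpha_bounds[OF \<beta> p s] a by auto
  have K0: "0 < K" using K(2) exp_gt_zero[of "exp (2/\<Delta>)"] by linarith
  have y: "2 * K \<le> 1 / p a" using small pos K0 by (simp add: field_simps)
  have "exp (2 / \<Delta>) \<le> - ln (p a)"
  proof -
    have "exp (exp (2/\<Delta>)) \<le> 1 / p a" using K(2) K0 y by linarith
    then have "exp (2/\<Delta>) \<le> ln (1 / p a)" using pos by (subst ln_ge_iff) auto
    then show ?thesis using pos by (simp add: ln_div)
  qed
  then have "2 / \<Delta> \<le> ln (exp 1 - ln (p a))"
    using exp_gt_zero[of "1::real"] exp_gt_zero[of "2/\<Delta>"] by (subst ln_ge_iff) linarith+
  then have "?A \<le> 1 / (2 / \<Delta>)" unfolding samba_alpha_def using \<beta> \<Delta> by (intro frac_le) auto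
  then have A2: "2 * ?A \<le> \<Delta>" by simp
  \<comment> \<open>The relative loss of \<open>a\<close> when the leader wins; \<open>?A\<close> is
    its relative gain when it wins itself.\<close>
  define u where "u = ?A * p a / p s"
  have "p a / p s \<le> 1" using leadersD[OF s, of a] pos by simp
  then have u: "0 < u" "u \<le> ?A"
    using A pos mult_left_mono[of "p a / p s" 1 ?A] by (auto simp: u_def)
  have up: "play \<beta> p s a a = p a * (1 + ?A)"
    using a pos by (simp add: play_challenger algebra_simps)
  have down: "play \<beta> p s s a = p a * (1 - u)"
    using a pos by (simp add: play_leader_loses u_def field_simps power2_eq_square)
  have fp: "?f p = 1 / p a" using y K0 by simp
  \<comment> \<open>The factor 2 in \<open>1 / (2 * K)\<close> keeps the truncation inactive after a
    gain, which at most doubles \<open>p a\<close>.\<close>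
  have fup: "?f (play \<beta> p s a) = 1 / (p a * (1 + ?A))"
  proof -
    have "p a * (1 + ?A) \<le> p a * 2" using pos A by (intro mult_left_mono) auto
    then have "K * (p a * (1 + ?A)) \<le> K * (p a * 2)" by (rule mult_left_mono) (use K0 in simp)
    also have "\<dots> \<le> 1" using small pos K0 by (simp add: field_simps)
    finally have "K \<le> 1 / (p a * (1 + ?A))" using pos A by (subst pos_le_divide_eq) auto
    then show ?thesis unfolding up by simp
  qed
  have fdown: "?f (play \<beta> p s s) = 1 / (p a * (1 - u))"
  proof -
    have "1 / p a \<le> 1 / (p a * (1 - u))" using pos u A by (intro divide_left_mono) auto
    then show ?thesis unfolding down using y K0 by simp
  qed
  have "drift \<beta> r ?f p s = p a * r a * (?f (play \<beta> p s a) - ?f p) + p s * r s * (?f (play \<beta> p s s) - ?f p)"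
    using a by (intro drift_two_arms[OF \<beta> p s]) (auto simp: play_bystander)
  also have "\<dots> = - (r a * ?A / (1 + ?A)) + r s * ?A / (1 - u)"
  proof -
    have "1 / (p a * (1 + ?A)) - 1 / p a = - ?A / (p a * (1 + ?A))"
      using pos A by (simp add: divide_simps)
    then have 1: "p a * r a * (1 / (p a * (1 + ?A)) - 1 / p a) = - (r a * ?A / (1 + ?A))"
      using pos by simp
    have "p s * r s * (1 / (p a * (1 - u)) - 1 / p a) = p s * r s * (u / (p a * (1 - u)))"
      using pos u A by (simp add: field_simps)
    also have "\<dots> = r s * ?A / (1 - u)" using pos u A by (simp add: u_def)
    finally show ?thesis unfolding fp fup fdown 1 by simp
  qed
  also have "\<dots> \<le> 0"
  proof -
    have "?A * r s \<le> ?A * 1" "u * r a \<le> ?A * 1"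
      by (intro mult_mono; use A r u in auto)+
    then have "r s * (1 + ?A) \<le> r a * (1 - u)"
      using \<Delta> A2 by (simp add: algebra_simps)
    then have "r s / (1 - u) \<le> r a / (1 + ?A)" using A u by (simp add: frac_le_eq divide_le_0_iff)
    then have "?A * (r s / (1 - u)) \<le> ?A * (r a / (1 + ?A))" using A by (intro mult_left_mono) auto
    then show ?thesis by (simp add: mult_ac)
  qed
  finally show ?thesis .
qed

text \<open>If \<open>a\<close> does not lead, its own term suffices. If it leads, some rival holds
  at least (1 - p a) / N and feeds it. In both cases a probability of at least \<open>x\<close>
  enters the increasing function \<open>?\<psi>\<close>.\<close>

lemma drift_best_ge:
  assumes card: "2 \<le> CARD('a)" and \<Delta>: "0 < \<Delta>" "\<And>b. b \<noteq> a \<Longrightarrow> r b \<le> r a - \<Delta>"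
    and x: "0 < x" "x \<le> p a" "x \<le> (1 - p a) / real CARD('a)"
  shows "\<Delta> * (samba_alpha \<beta> x * x\<^sup>2) \<le> drift \<beta> r (\<lambda>p. p a) p s"
proof -
  let ?\<psi> = "\<lambda>x. samba_alpha \<beta> x * x\<^sup>2"
  have \<psi>: "?\<psi> x \<le> ?\<psi> (p b)" if "x \<le> p b" for b
    using that x samba_alpha_mono[OF \<beta>(1) x(1) that] samba_alpha_pos[OF \<beta>(1) x(1)] open_simplexD(2)[OF p, of b]
    by (intro mult_mono power_mono) (auto intro: less_imp_le)
  have \<psi>0: "0 \<le> ?\<psi> (p b)" for b using alpha_bounds(1)[OF \<beta> p s, of b] by auto
  show ?thesis
  proof (cases "a = s")
    case False
    have "\<Delta> * ?\<psi> x \<le> (r a - r s) * ?\<psi> (p a)"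
      using less_imp_le[OF \<Delta>(1)] \<Delta>(2)[of s] False \<psi>[OF x(2)] \<psi>0[of a] alpha_bounds(1)[OF \<beta> p s, of a] samba_alpha_pos[OF \<beta>(1) x(1)] x(2) open_simplexD(2)[OF p, of a]
      by (intro mult_mono[of \<Delta>]) auto
    then show ?thesis unfolding drift_not_leader[OF \<beta> p s False] by (simp add: mult_ac)
  next
    case True
    \<comment> \<open>Otherwise the N - 1 rivals together would hold less than N x \<le> 1 - p
      s.\<close>
    have "\<exists>b. b \<noteq> s \<and> x \<le> p b"
    proof (rule ccontr)
      assume "\<not> ?thesis"
      then have "sum p (UNIV - {s}) \<le> (\<Sum>b\<in>UNIV - {s}. x)" by (intro sum_mono) force
      also have "\<dots> = (real CARD('a) - 1) * x" using card by (simp add: card_Diff_singleton of_nat_diff)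
      also have "\<dots> < real CARD('a) * x" using x by simp
      also have "\<dots> \<le> 1 - p s" using x(3) True card by (simp add: field_simps)
      finally show False using open_simplexD(3)[OF p] by (simp add: sum.remove[of UNIV s])
    qed
    then obtain b where b: "b \<noteq> s" "x \<le> p b" by auto
    have "\<Delta> * ?\<psi> x \<le> (r s - r b) * ?\<psi> (p b)"
      using \<Delta>(1) \<Delta>(2)[of b] True b \<psi>[OF b(2)] \<psi>0[of b] alpha_bounds(1)[OF \<beta> p s, of b] samba_alpha_pos[OF \<beta>(1) x(1)] open_simplexD(2)[OF p, of b]
      by (intro mult_mono[of \<Delta>]) auto
    also have "\<dots> = ?\<psi> (p b) * (r s - r b)" by simp
    also have "\<dots> \<le> (\<Sum>b\<in>UNIV-{s}. ?\<psi> (p b) * (r s - r b))"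
    proof (rule member_le_sum)
      show "0 \<le> ?\<psi> (p b') * (r s - r b')" if "b' \<in> UNIV - {s} - {b}" for b'
        using that \<psi>0[of b'] \<Delta>(1) \<Delta>(2)[of b'] True by (intro mult_nonneg_nonneg[OF \<psi>0]) auto
    qed (use b in auto)
    finally show ?thesis unfolding drift_leader[OF \<beta> p s] True .
  qed
qed

end

section \<open>The potential function\<close>

text \<open>The antiderivative of \<open>\<lambda>x. ln (exp 1 + x)\<close> that vanishes at 0.\<close>

definition J :: "real \<Rightarrow> real" where
  "J x = (exp 1 + x) * (ln (exp 1 + x) - 1)"

lemma J_0 [simp]: "J 0 = 0"
  by (simp add: J_def)

lemma e_plus_pos: "0 \<le> x \<Longrightarrow> 0 < exp 1 + (x::real)"
  by (simp add: add_pos_nonneg)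

lemma ln_e_plus_ge_1: "0 \<le> x \<Longrightarrow> 1 \<le> ln (exp 1 + (x::real))"
  by (subst ln_ge_iff) (auto simp: e_plus_pos)

lemma ln_diff_le': "0 < x \<Longrightarrow> 0 < y \<Longrightarrow> ln y - ln x \<le> (y - x) / (x::real)"
  using ln_diff_le[of y x] by simp

text \<open>Convexity of \<open>J\<close>; after expansion it is w (ln z - ln w) \<le> z -
  w.\<close>

lemma J_tangent:
  assumes "0 \<le> u" "0 \<le> v"
  shows "J u + ln (exp 1 + u) * (v - u) \<le> J v"
proof -
  define w z where "w = exp 1 + v" and "z = exp 1 + u"
  have pos: "0 < w" "0 < z" using assms by (auto simp: w_def z_def e_plus_pos)
  have "w * (ln z - ln w) \<le> w * ((z - w) / w)"
    using pos ln_diff_le'[of w z] by (intro mult_left_mono) auto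
  also have "\<dots> = z - w" using pos by simp
  finally have "w * ln z - w * ln w \<le> z - w" by (simp add: right_diff_distrib)
  moreover have "v - u = w - z" by (simp add: w_def z_def)
  then have "ln z * (v - u) = w * ln z - z * ln z" by (simp only: right_diff_distrib mult.commute)
  ultimately show ?thesis unfolding J_def w_def[symmetric] z_def[symmetric] by (simp add: algebra_simps)
qed

lemma J_nonneg: "0 \<le> x \<Longrightarrow> 0 \<le> J x"
  using J_tangent[of 0 x] by simp

lemma J_mono: "0 \<le> x \<Longrightarrow> x \<le> y \<Longrightarrow> J x \<le> J y"
  using J_tangent[of x y] ln_e_plus_ge_1[of x] mult_nonneg_nonneg[of "ln (exp 1 + x)" "y - x"] by linarith

lemma DERIV_J: "0 \<le> x \<Longrightarrow> (J has_real_derivative ln (exp 1 + x)) (at x)"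
  unfolding J_def[abs_def] using e_plus_pos[of x]
  by (auto intro!: derivative_eq_intros)

text \<open>\<open>J L\<close> is the integral of the concave function ln (e + x) over [0, L], which
  the midpoint rule overestimates.\<close>

lemma J_le_midpoint:
  assumes "0 \<le> L"
  shows "J L \<le> L * ln (exp 1 + L / 2)"
proof -
  let ?g = "\<lambda>x. x * ln (exp 1 + x / 2) - J x"
  have "?g 0 \<le> ?g L"
  proof (rule DERIV_nonneg_imp_nondecreasing[OF assms])
    fix x :: real assume x: "0 \<le> x" "x \<le> L"
    let ?c = "exp 1 + x / 2"
    have c: "0 < ?c" "0 < exp 1 + x" using x e_plus_pos[of "x/2"] e_plus_pos[of x] by auto
    have "(?g has_real_derivative (ln ?c + x * ((1/2) / ?c) - ln (exp 1 + x))) (at x)"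
      using c x by (auto intro!: derivative_eq_intros DERIV_J)
    moreover have "ln (exp 1 + x) - ln ?c \<le> (exp 1 + x - ?c) / ?c"
      using c by (intro ln_diff_le') auto
    ultimately show "\<exists>y. (?g has_real_derivative y) (at x) \<and> 0 \<le> y"
      by (intro exI conjI) (auto simp: field_simps)
  qed
  then show ?thesis by simp
qed

text \<open>The quotient is the derivative of J (ln y), so this is concavity of that function for y
  \<ge> 1. The numerator is at least 1 and grows no faster than ln y, hence relatively slower than
  y.\<close>

lemma slope_J_ln_antimono:
  fixes x y :: real
  assumes "1 \<le> x" "x \<le> y"
  shows "ln (exp 1 + ln y) / y \<le> ln (exp 1 + ln x) / x"
proof -
  have pos: "0 \<le> ln x" "0 \<le> ln y" using assms ln_ge_zero[of x] ln_ge_zero[of y] by linarith+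
  have e: "1 \<le> exp (1::real)" by simp
  have "ln (exp 1 + ln y) - ln (exp 1 + ln x) \<le> (ln y - ln x) / (exp 1 + ln x)"
    using ln_diff_le'[of "exp 1 + ln x" "exp 1 + ln y"] pos by (simp add: e_plus_pos)
  also have "\<dots> \<le> (ln y - ln x) / 1"
    using assms pos e by (intro divide_left_mono) (auto simp: e_plus_pos intro: add_increasing2)
  also have "\<dots> \<le> 1 * ((y - x) / x)" using ln_diff_le'[of x y] assms by simp
  also have "\<dots> \<le> ln (exp 1 + ln x) * ((y - x) / x)"
    using assms pos by (intro mult_right_mono ln_e_plus_ge_1) auto
  finally have "ln (exp 1 + ln y) \<le> ln (exp 1 + ln x) * (y / x)"
    using assms by (simp add: field_simps)
  then show ?thesis using assms by (simp add: field_simps)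
qed

lemma DERIV_J_ln:
  assumes "1 \<le> x"
  shows "((\<lambda>y. J (ln y)) has_real_derivative ln (exp 1 + ln x) / x) (at x)"
  using DERIV_chain2[OF DERIV_J[of "ln x"] DERIV_ln[of x]] assms by (simp add: divide_inverse)

text \<open>Concavity in tangent form, ready for Jensen's inequality.\<close>

lemma J_ln_tangent:
  assumes "1 \<le> x" "1 \<le> y"
  shows "J (ln y) \<le> J (ln x) + ln (exp 1 + ln x) / x * (y - x)"
proof (cases x y rule: linorder_cases)
  case less
  obtain z where z: "x < z" "z < y" "J (ln y) - J (ln x) = (y - x) * (ln (exp 1 + ln z) / z)"
    using MVT2[OF less, of "\<lambda>y. J (ln y)" "\<lambda>z. ln (exp 1 + ln z) / z"] assms DERIV_J_ln by force
  have "(y - x) * (ln (exp 1 + ln z) / z) \<le> (y - x) * (ln (exp 1 + ln x) / x)"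
    using z assms by (intro mult_left_mono slope_J_ln_antimono) auto
  then show ?thesis using z by (simp add: mult_ac)
next
  case greater
  obtain z where z: "y < z" "z < x" "J (ln x) - J (ln y) = (x - y) * (ln (exp 1 + ln z) / z)"
    using MVT2[OF greater, of "\<lambda>y. J (ln y)" "\<lambda>z. ln (exp 1 + ln z) / z"] assms DERIV_J_ln by force
  have "(x - y) * (ln (exp 1 + ln x) / x) \<le> (x - y) * (ln (exp 1 + ln z) / z)"
    using z assms by (intro mult_left_mono slope_J_ln_antimono) auto
  then have "J (ln y) \<le> J (ln x) - (x - y) * (ln (exp 1 + ln x) / x)" using z by linarith
  moreover have "(x - y) * c = - (c * (y - x))" for c by (simp add: algebra_simps)
  ultimately show ?thesis by simp
qed auto

text \<open>Concave functions have decreasing increments; this removes the initial state from the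
  regret bound.\<close>

lemma J_ln_increment_antimono:
  assumes "1 \<le> x" "x \<le> y" "0 \<le> c"
  shows "J (ln (y + c)) - J (ln y) \<le> J (ln (x + c)) - J (ln x)"
proof -
  let ?g = "\<lambda>y. J (ln (y + c)) - J (ln y)"
  show ?thesis
  proof (rule DERIV_nonpos_imp_nonincreasing[OF assms(2)])
    fix z assume z: "x \<le> z" "z \<le> y"
    have "(?g has_real_derivative (ln (exp 1 + ln (z + c)) / (z + c) - ln (exp 1 + ln z) / z)) (at z)"
      using z assms by (intro DERIV_diff DERIV_J_ln DERIV_shift[THEN iffD1]) auto
    moreover have "ln (exp 1 + ln (z + c)) / (z + c) \<le> ln (exp 1 + ln z) / z"
      using z assms by (intro slope_J_ln_antimono) auto
    ultimately show "\<exists>d. (?g has_real_derivative d) (at z) \<and> d \<le> 0"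
      by (intro exI conjI) auto
  qed
qed

text \<open>An antiderivative of \<open>\<lambda>x. 1 / (samba_alpha \<beta> x * x)\<close>.\<close>

definition potential :: "real \<Rightarrow> real \<Rightarrow> real" where
  "potential \<beta> x = - J (- ln x) / \<beta>"

text \<open>Concavity in two steps: convexity of \<open>J\<close> at \<open>- ln x\<close>, then ln
  y - ln x \<le> (y - x) / x.\<close>

lemma potential_tangent:
  assumes "0 < \<beta>" "0 < x" "x \<le> 1" "0 < y" "y \<le> 1"
  shows "potential \<beta> y - potential \<beta> x \<le> 1 / (samba_alpha \<beta> x * x) * (y - x)"
proof -
  have 1: "1 \<le> ln (exp 1 - ln x)" using assms by (intro one_le_ln_e_minus_ln)
  have "J (- ln x) - J (- ln y) \<le> ln (exp 1 - ln x) * (ln y - ln x)"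
    using J_tangent[of "- ln x" "- ln y"] assms by (simp add: algebra_simps)
  also have "\<dots> \<le> ln (exp 1 - ln x) * ((y - x) / x)"
    using assms 1 by (intro mult_left_mono ln_diff_le') auto
  finally have "(J (- ln x) - J (- ln y)) / \<beta> \<le> ln (exp 1 - ln x) * ((y - x) / x) / \<beta>"
    using assms by (intro divide_right_mono) auto
  then show ?thesis using assms 1 by (simp add: potential_def samba_alpha_def field_simps)
qed

text \<open>The slope of the potential cancels the learning rate, so a non-leader contributes at
  most p a (r a - r s). If \<open>c\<close> leads, these terms sum to minus the regret. Otherwise
  the leader is among the summed arms; adding its drift leaves at most the mean reward, and the
  extra 1 covers \<open>r c\<close>.\<close>

lemma drift_potential_le:
  fixes p r :: "'a::finite \<Rightarrow> real"
  assumes \<beta>: "0 < \<beta>" "\<beta> \<le> 1" and p: "p \<in> open_simplex" and s: "s \<in> leaders p"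
    and r: "\<And>a. 0 \<le> r a" "\<And>a. r a \<le> 1" "\<And>b. r b \<le> r c"
  shows "drift \<beta> r (\<lambda>p. \<Sum>a\<in>UNIV - {c}. potential \<beta> (p a)) p s
    \<le> (if s = c then 0 else 1) - (r c - (\<Sum>a\<in>UNIV. p a * r a))"
proof -
  note pD = open_simplexD(1,2)[OF p] and qD = open_simplexD(1,2)[OF play_in_open_simplex[OF \<beta> p s]]
  have \<alpha>: "0 < samba_alpha \<beta> (p a)" for a using alpha_bounds(1)[OF \<beta> p s] .
  have tangent: "drift \<beta> r (\<lambda>p. potential \<beta> (p a)) p s
      \<le> 1 / (samba_alpha \<beta> (p a) * p a) * drift \<beta> r (\<lambda>p. p a) p s" for a
    using r pD qD \<beta> by (intro drift_mono[OF \<beta> p s] potential_tangent) auto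
  have not_leader: "drift \<beta> r (\<lambda>p. potential \<beta> (p a)) p s \<le> p a * (r a - r s)" if "a \<noteq> s" for a
  proof -
    have "1 / (samba_alpha \<beta> (p a) * p a) * (samba_alpha \<beta> (p a) * (p a)\<^sup>2 * (r a - r s)) = p a * (r a - r s)"
      using pD(1)[of a] \<alpha>[of a] by (simp add: power2_eq_square)
    then show ?thesis using tangent[of a] unfolding drift_not_leader[OF \<beta> p s that] by simp
  qed
  have total: "sum p UNIV = 1" using open_simplexD(3)[OF p] .
  show ?thesis
  proof (cases "s = c")
    case True
    have "drift \<beta> r (\<lambda>p. \<Sum>a\<in>UNIV - {c}. potential \<beta> (p a)) p s \<le> (\<Sum>a\<in>UNIV-{c}. p a * (r a - r s))"
      unfolding drift_sum[OF \<beta> p s] using True by (intro sum_mono not_leader) auto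
    also have "\<dots> = (\<Sum>a\<in>UNIV. p a * (r a - r s))" using True by (simp add: sum.remove[of UNIV c])
    also have "\<dots> = (\<Sum>a\<in>UNIV. p a * r a) - r s"
      using total by (simp add: right_diff_distrib sum_subtractf flip: sum_distrib_right)
    finally show ?thesis using True by simp
  next
    case False
    let ?B = "UNIV - {s} - {c}"
    \<comment> \<open>As \<open>p b \<le> p s\<close> and the rate is monotone, the weight of the
      rival \<open>b\<close> is at most \<open>p b\<close>; the term of \<open>c\<close> is at most
      0 because \<open>r s \<le> r c\<close>.\<close>
    have lead: "drift \<beta> r (\<lambda>p. potential \<beta> (p s)) p s \<le> (\<Sum>b\<in>?B. p b * r s)"
    proof -
      have "samba_alpha \<beta> (p b) * (p b)\<^sup>2 * (r s - r b) / (samba_alpha \<beta> (p s) * p s)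
          \<le> (if b = c then 0 else p b * r s)" for b
      proof -
        let ?w = "samba_alpha \<beta> (p b) * (p b)\<^sup>2 / (samba_alpha \<beta> (p s) * p s)"
        have "samba_alpha \<beta> (p b) * (p b * p b) \<le> samba_alpha \<beta> (p s) * (p b * p s)"
          using leadersD[OF s, of b] pD[of b] pD[of s] \<alpha>[of b] \<alpha>[of s] \<beta>
          by (intro mult_mono samba_alpha_mono) (auto intro: less_imp_le)
        then have w: "0 \<le> ?w" "?w \<le> p b"
          using pD(1)[of s] pD(1)[of b] \<alpha>[of b] \<alpha>[of s] by (auto simp: field_simps power2_eq_square)
        show ?thesis
        proof (cases "b = c")
          case True
          then show ?thesis using w(1) r(3)[of s] mult_nonneg_nonpos[of ?w "r s - r b"] by simp
        next
          case False
          have "?w * (r s - r b) \<le> ?w * r s" using w r(1)[of b] by (intro mult_left_mono) auto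
          also have "\<dots> \<le> p b * r s" using w r by (intro mult_right_mono) auto
          finally show ?thesis using False by simp
        qed
      qed
      then have "(\<Sum>b\<in>UNIV-{s}. samba_alpha \<beta> (p b) * (p b)\<^sup>2 * (r s - r b) / (samba_alpha \<beta> (p s) * p s))
          \<le> (\<Sum>b\<in>UNIV-{s}. if b = c then 0 else p b * r s)" by (intro sum_mono)
      also have "\<dots> = (\<Sum>b\<in>?B. p b * r s)" by (rule sum.mono_neutral_cong_right) auto
      finally show ?thesis
        using tangent[of s] unfolding drift_leader[OF \<beta> p s] by (simp add: sum_divide_distrib)
    qed
    have eq: "UNIV - {c} = insert s ?B" using False by auto
    have "drift \<beta> r (\<lambda>p. \<Sum>a\<in>UNIV - {c}. potential \<beta> (p a)) p s
       = drift \<beta> r (\<lambda>p. potential \<beta> (p s)) p s + (\<Sum>a\<in>?B. drift \<beta> r (\<lambda>p. potential \<beta> (p a)) p s)"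
      unfolding drift_sum[OF \<beta> p s] eq by simp
    also have "\<dots> \<le> (\<Sum>b\<in>?B. p b * r s) + (\<Sum>b\<in>?B. p b * (r b - r s))"
      by (intro add_mono lead sum_mono not_leader) auto
    also have "\<dots> = (\<Sum>b\<in>?B. p b * r b)" by (simp add: sum.distrib[symmetric] algebra_simps)
    also have "\<dots> \<le> (\<Sum>b\<in>UNIV. p b * r b)"
      using less_imp_le[OF pD(1)] r(1) by (intro sum_mono2 mult_nonneg_nonneg) auto
    finally show ?thesis using False r(2)[of c] by simp
  qed
qed

section \<open>Numerical estimates\<close>

lemma e_ge: "271/100 \<le> exp (1::real)"
proof -
  \<comment> \<open>The eighth power of the quadratic Taylor bound for exp (1/8).\<close>
  have "(271/100::real) \<le> (1 + 1/8 + (1/8)\<^sup>2 / 2) ^ 8" by (simp add: power_divide field_simps)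
  also have "\<dots> \<le> exp (1/8) ^ 8"
    using exp_lower_Taylor_quadratic[of "1/8"] by (intro power_mono) auto
  also have "\<dots> = exp (1::real)" by (simp flip: exp_of_nat_mult)
  finally show ?thesis .
qed

text \<open>The hypothesis, a statement on natural numbers so that it can be evaluated, says \<open>(68/25)\<^sup>a \<le> (c/d)\<^sup>b\<close>, and \<open>e < 68/25\<close>.\<close>

lemma ln_ge_ratio:
  fixes a b c d :: nat
  assumes "68 ^ a * d ^ b \<le> c ^ b * 25 ^ a" "0 < c" "0 < d" "0 < b"
  shows "real a / real b \<le> ln (real c / real d)"
proof -
  have "real (68 ^ a * d ^ b) \<le> real (c ^ b * 25 ^ a)" using assms(1) by (rule of_nat_mono)
  then have *: "(68/25) ^ a \<le> (real c / real d) ^ b"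
    using assms by (simp add: power_divide field_simps)
  have "exp (real a) = exp 1 ^ a" by (simp flip: exp_of_nat_mult)
  also have "\<dots> \<le> (68/25) ^ a" using e_less_272 by (intro power_mono) auto
  also note *
  finally have "real a \<le> ln ((real c / real d) ^ b)" using assms by (subst ln_ge_iff) auto
  also have "\<dots> = real b * ln (real c / real d)" using assms by (simp add: ln_realpow)
  finally show ?thesis using assms by (simp add: field_simps)
qed

abbreviation (input) loglog :: "real \<Rightarrow> real" where
  "loglog x \<equiv> ln x * ln (exp 1 + ln x)"

lemma loglog_nonneg: "1 \<le> x \<Longrightarrow> 0 \<le> loglog x"
  using ln_e_plus_ge_1[of "ln x"] by (intro mult_nonneg_nonneg) auto

text \<open>Rational certificates: \<open>q\<close> lies below ln y and \<open>z\<close> below e +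
  q, so \<open>k\<close> lies below the second factor.\<close>

lemma loglog_ge:
  fixes q k x y z :: real
  assumes "q \<le> ln x" "0 \<le> q" "0 < x" "x \<le> y" "k \<le> ln z" "0 \<le> k" "0 < z" "z \<le> 271/100 + q"
  shows "q * k \<le> loglog y"
proof -
  have "ln x \<le> ln y" using assms by simp
  then have 1: "q \<le> ln y" using assms by linarith
  have "ln z \<le> ln (exp 1 + ln y)"
    using 1 e_ge assms by (subst ln_le_cancel_iff) (auto simp: add_pos_nonneg)
  then have "k \<le> ln (exp 1 + ln y)" "0 \<le> ln y" using 1 assms by linarith+
  then show ?thesis using 1 assms by (intro mult_mono) auto
qed

text \<open>(c + T) / T decreases in T and m \<le> n, so (c + T)^m \<le> T^n persists from
  \<open>T0\<close> on, and one numerical check suffices.\<close>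

lemma mult_ln_le_mult_ln:
  fixes T T0 :: real
  assumes "(c + T0) ^ m \<le> T0 ^ n" "0 < T0" "T0 \<le> T" "0 \<le> c" "m \<le> n"
  shows "real m * ln (c + T) \<le> real n * ln T"
proof -
  have "ln ((c + T0) ^ m) \<le> ln (T0 ^ n)" using assms by (subst ln_le_cancel_iff) auto
  then have 1: "real m * ln (c + T0) \<le> real n * ln T0" using assms by (simp add: ln_realpow)
  have "(c + T) / (c + T0) \<le> T / T0" using assms mult_left_mono[of T0 T c] by (simp add: field_simps)
  then have "ln ((c + T) / (c + T0)) \<le> ln (T / T0)" using assms by (subst ln_le_cancel_iff) auto
  then have 2: "ln (c + T) - ln (c + T0) \<le> ln T - ln T0" using assms by (simp add: ln_div)
  have "real m * (ln (c + T) - ln (c + T0)) \<le> real m * (ln T - ln T0)" using 2 by (intro mult_left_mono) auto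
  also have "\<dots> \<le> real n * (ln T - ln T0)" using assms by (intro mult_right_mono) auto
  finally show ?thesis using 1 by (simp add: algebra_simps)
qed

text \<open>\<open>\<kappa>\<close> stands for the cost of replacing T by 6 N + T under the
  logarithm. The midpoint rule evaluates ln only at \<open>c\<close>, with 4/3 c \<le> e + l; the
  resulting slack l ln (4/3) pays for \<kappa> ln c.\<close>

lemma large_horizon:
  fixes \<kappa> l :: real
  assumes l: "4 \<le> l" and \<kappa>: "0 \<le> \<kappa>" "\<kappa> \<le> 63/100"
  shows "J (l + \<kappa>) \<le> l * ln (exp 1 + l)"
proof -
  define c where "c = exp 1 + (l + \<kappa>) / 2"
  have e: "271/100 \<le> exp (1::real)" "exp (1::real) \<le> 272/100" using e_ge e_less_272 by auto
  have c: "0 < c" using l \<kappa> unfolding c_def by (intro e_plus_pos) auto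
  \<comment> \<open>4/3 = 8/7 * 7/6, and 1/8 + 1/7 > 267/1000.\<close>
  have "1 / 8 \<le> ln (8/7::real)" using ln_ge_ratio[of 1 7 8 8] by simp
  moreover have "1 / 7 \<le> ln (7/6::real)" using ln_ge_ratio[of 1 6 7 7] by simp
  moreover have "ln (8/7 * (7/6::real)) = ln (8/7) + ln (7/6)" by (subst ln_mult) auto
  ultimately have "267/1000 \<le> ln (4/3::real)" by simp
  moreover have "ln (4/3 * c) \<le> ln (exp 1 + l)"
    using c l \<kappa> e by (subst ln_le_cancel_iff) (auto simp: c_def add_pos_nonneg add_divide_distrib)
  moreover have "ln (4/3 * c) = ln (4/3) + ln c" using c by (subst ln_mult) auto
  ultimately have 1: "ln c + 267/1000 \<le> ln (exp 1 + l)" by linarith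
  \<comment> \<open>The tangent of ln at 2 e, followed by 2 e \<ge> 5.\<close>
  have "ln c - ln (2 * exp 1) \<le> (c - 2 * exp 1) / (2 * exp 1)" using c by (intro ln_diff_le') auto
  also have "\<dots> = ((l + \<kappa>) / 2) / (2 * exp 1) - 1 / 2" by (simp add: c_def field_simps)
  also have "((l + \<kappa>) / 2) / (2 * exp 1) \<le> ((l + \<kappa>) / 2) / 5" using l \<kappa> e by (intro divide_left_mono) auto
  finally have "ln c \<le> ln (2 * exp 1) + (l + \<kappa>) / 10 - 1 / 2" by simp
  also have "ln (2 * exp 1) = ln 2 + (1::real)" by (subst ln_mult) auto
  finally have 2: "ln c \<le> 25/36 + 1/2 + (l + \<kappa>) / 10" using ln2_le_25_over_36 by simp
  then have "ln c \<le> 422/1000 * l" using l \<kappa> by (simp add: add_divide_distrib)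
  moreover have "1 \<le> c" using e l \<kappa> unfolding c_def by (simp add: add_divide_distrib)
  ultimately have "\<kappa> * ln c \<le> 63/100 * (422/1000 * l)" using l \<kappa> by (intro mult_mono) auto
  then have 3: "\<kappa> * ln c \<le> l * (267/1000)" using l by simp
  have "J (l + \<kappa>) \<le> (l + \<kappa>) * ln c" using J_le_midpoint[of "l + \<kappa>"] l \<kappa> by (simp add: c_def)
  also have "\<dots> \<le> l * (ln c + 267/1000)" using 3 by (simp add: algebra_simps)
  also have "\<dots> \<le> l * ln (exp 1 + l)" using 1 l by (intro mult_left_mono) auto
  finally show ?thesis .
qed

text \<open>For \<open>2 \<le> N \<le> 7\<close> the hypothesis forces \<open>T\<close> to be at least 4, 9, 16, 25, 35, 47, respectively,
  and these are values where \<open>(6 N + T) ^ (N - 1) \<le> T ^ N\<close>; for \<open>8 \<le> N\<close> it cannot hold.\<close>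

lemma small_horizon:
  fixes N T :: nat
  assumes N: "2 \<le> N" and T: "1 \<le> T" "T \<le> 54" and gt: "real N * loglog (real T) + 1 < real T"
  shows "real (N - 1) * ln (6 * real N + real T) \<le> real N * ln (real T)"
proof -
  have A: "k * loglog (real T) \<le> real N * loglog (real T)" if "k \<le> real N" for k
    using that T loglog_nonneg[of "real T"] by (intro mult_right_mono) auto
  have T1: "T \<noteq> 1" using gt by auto
  have ln2: "9/13 \<le> ln (2::real)" using ln_ge_ratio[of 9 1 13 2] by simp
  have ln3: "12/11 \<le> ln (3::real)" using ln_ge_ratio[of 12 1 11 3] by simp
  have ln5: "8/5 \<le> ln (5::real)" using ln_ge_ratio[of 8 1 5 5] by simp
  have ln: "ln (4::real) = 2 * ln 2" "ln (6::real) = ln 2 + ln 3" "ln (8::real) = 3 * ln 2"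
    "ln (12::real) = 2 * ln 2 + ln 3" "ln (16::real) = 4 * ln 2" "ln (24::real) = 3 * ln 2 + ln 3"
    "ln (32::real) = 5 * ln 2" "ln (40::real) = 3 * ln 2 + ln 5"
    using ln_realpow[of 2 2] ln_realpow[of 2 3] ln_realpow[of 2 4] ln_realpow[of 2 5]
      ln_mult[of "2::real" 3] ln_mult[of "4::real" 3] ln_mult[of "8::real" 3] ln_mult[of "8::real" 5]
    by simp_all
  \<comment> \<open>Lower bounds of \<open>loglog\<close> from certain breakpoints on. The first
    fraction bounds the logarithm of the breakpoint by means of ln 2, ln 3 and ln 5; the next one
    bounds the second factor.\<close>
  have b2: "82/100 \<le> loglog (real T)" if "2 \<le> T"
    using loglog_ge[of "9/13" 2 "real T" "6/5" "340/100"] ln_ge_ratio[of 6 100 5 340] ln ln2 ln3 ln5 that by simp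
  have b3: "1 \<le> loglog (real T)" if "3 \<le> T"
    using loglog_ge[of "12/11" 3 "real T" "5/4" "380/100"] ln_ge_ratio[of 5 100 4 380] ln ln2 ln3 ln5 that by simp
  have b4: "193/100 \<le> loglog (real T)" if "4 \<le> T"
    using loglog_ge[of "18/13" 4 "real T" "7/5" "409/100"] ln_ge_ratio[of 7 100 5 409] ln ln2 ln3 ln5 that by simp
  have b6: "249/100 \<le> loglog (real T)" if "6 \<le> T"
    using loglog_ge[of "255/143" 6 "real T" "7/5" "449/100"] ln_ge_ratio[of 7 100 5 449] ln ln2 ln3 ln5 that by simp
  have b8: "311/100 \<le> loglog (real T)" if "8 \<le> T"
    using loglog_ge[of "27/13" 8 "real T" "3/2" "478/100"] ln_ge_ratio[of 3 100 2 478] ln ln2 ln3 ln5 that by simp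
  have b12: "395/100 \<le> loglog (real T)" if "12 \<le> T"
    using loglog_ge[of "354/143" 12 "real T" "8/5" "518/100"] ln_ge_ratio[of 8 100 5 518] ln ln2 ln3 ln5 that by simp
  have b16: "461/100 \<le> loglog (real T)" if "16 \<le> T"
    using loglog_ge[of "36/13" 16 "real T" "5/3" "547/100"] ln_ge_ratio[of 5 100 3 547] ln ln2 ln3 ln5 that by simp
  have b24: "554/100 \<le> loglog (real T)" if "24 \<le> T"
    using loglog_ge[of "453/143" 24 "real T" "7/4" "587/100"] ln_ge_ratio[of 7 100 4 587] ln ln2 ln3 ln5 that by simp
  have b32: "622/100 \<le> loglog (real T)" if "32 \<le> T"
    using loglog_ge[of "45/13" 32 "real T" "9/5" "617/100"] ln_ge_ratio[of 9 100 5 617] ln ln2 ln3 ln5 that by simp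
  have b40: "674/100 \<le> loglog (real T)" if "40 \<le> T"
    using loglog_ge[of "239/65" 40 "real T" "11/6" "638/100"] ln_ge_ratio[of 11 100 6 638] ln ln2 ln3 ln5 that by simp
  note b = b2 b3 b4 b6 b8 b12 b16 b24 b32 b40
  consider "N = 2" | "N = 3" | "N = 4" | "N = 5" | "N = 6" | "N = 7" | "8 \<le> N" using N by linarith
  then show ?thesis
  proof cases
    case 1
    \<comment> \<open>A range of T starting at a breakpoint is excluded once N times the bound
      there, plus 1, reaches its right end. \<open>gt\<close> is strict, so equality suffices, as
      for T = 3.\<close>
    have "4 \<le> T"
    proof (rule ccontr)
      assume "\<not> 4 \<le> T"
      then have "T = 2 \<or> T = 3" using T T1 by linarith
      then show False using gt b2 b3 1 by auto
    qed
    \<comment> \<open>The check at T0 = 4 is the equality 12 + 4 = 4^2.\<close>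
    then show ?thesis using 1 mult_ln_le_mult_ln[of 12 4 1 2 "real T"] by simp
  next
    case 2
    have "9 \<le> T"
    proof (rule ccontr)
      assume "\<not> 9 \<le> T"
      then consider "2 \<le> T" "T \<le> 3" | "4 \<le> T" "T \<le> 5" | "6 \<le> T" "T \<le> 8" using T T1 by linarith
      then show False by cases (use gt b 2 in auto)
    qed
    then show ?thesis using 2 mult_ln_le_mult_ln[of 18 9 2 3 "real T"] by simp
  next
    case 3
    have "16 \<le> T"
    proof (rule ccontr)
      assume "\<not> 16 \<le> T"
      then consider "2 \<le> T" "T \<le> 3" | "4 \<le> T" "T \<le> 8" | "8 \<le> T" "T \<le> 12" | "12 \<le> T" "T \<le> 15" using T T1 by linarith
      then show False by cases (use gt b 3 in auto)
    qed
    then show ?thesis using 3 mult_ln_le_mult_ln[of 24 16 3 4 "real T"] by simp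
  next
    case 4
    have "25 \<le> T"
    proof (rule ccontr)
      assume "\<not> 25 \<le> T"
      then consider "2 \<le> T" "T \<le> 4" | "4 \<le> T" "T \<le> 8" | "8 \<le> T" "T \<le> 16" | "16 \<le> T" "T \<le> 24" using T T1 by linarith
      then show False by cases (use gt b 4 in auto)
    qed
    then show ?thesis using 4 mult_ln_le_mult_ln[of 30 25 4 5 "real T"] by simp
  next
    case 5
    have "35 \<le> T"
    proof (rule ccontr)
      assume "\<not> 35 \<le> T"
      then consider "2 \<le> T" "T \<le> 4" | "4 \<le> T" "T \<le> 8" | "8 \<le> T" "T \<le> 16" | "16 \<le> T" "T \<le> 24" | "24 \<le> T" "T \<le> 34"
        using T T1 by linarith
      then show False by cases (use gt b 5 in auto)
    qed
    then show ?thesis using 5 mult_ln_le_mult_ln[of 36 35 5 6 "real T"] by simp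
  next
    case 6
    have "47 \<le> T"
    proof (rule ccontr)
      assume "\<not> 47 \<le> T"
      then consider "2 \<le> T" "T \<le> 4" | "4 \<le> T" "T \<le> 8" | "8 \<le> T" "T \<le> 16" | "16 \<le> T" "T \<le> 32" | "32 \<le> T" "T \<le> 40" | "40 \<le> T" "T \<le> 46"
        using T T1 by linarith
      then show False by cases (use gt b 6 in auto)
    qed
    then show ?thesis using 6 mult_ln_le_mult_ln[of 42 47 6 7 "real T"] by simp
  next
    case 7
    \<comment> \<open>N = 8 already excludes all T \<le> 54, and a larger \<open>N\<close> makes
      \<open>gt\<close> stronger.\<close>
    then have gt8: "8 * loglog (real T) + 1 < real T" using A[of 8] gt by simp
    consider "2 \<le> T" "T \<le> 4" | "4 \<le> T" "T \<le> 8" | "8 \<le> T" "T \<le> 16" | "16 \<le> T" "T \<le> 32" | "32 \<le> T" "T \<le> 40" | "40 \<le> T" "T \<le> 54"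
      using T T1 by linarith
    then have False by cases (use gt8 b in auto)
    then show ?thesis ..
  qed
qed

text \<open>When \<open>gt\<close> fails, the trivial bound T on the regret is good enough. When it
  holds, T is large compared with N and 6 N is a minor correction: for ln T \<ge> 4 the midpoint
  rule has room for it, and otherwise T \<le> 54 is a finite check.\<close>

lemma horizon_dichotomy:
  fixes N T :: nat
  assumes N: "2 \<le> N" and T: "1 \<le> T" and gt: "real N * loglog (real T) + 1 < real T"
  shows "real (N - 1) * J (ln (6 * real N + real T)) \<le> real N * loglog (real T)"
proof -
  define l L where "l = ln (real T)" and "L = ln (6 * real N + real T)"
  have l0: "0 \<le> l" "l \<le> L" using T N by (auto simp: l_def L_def)
  have G: "1 \<le> ln (exp 1 + l)" using l0 by (intro ln_e_plus_ge_1)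
  show ?thesis
  proof (cases "4 \<le> l")
    case True
    \<comment> \<open>74/10 = 4 * 185/100, where 671/100 \<le> e + 4.\<close>
    have A: "74/10 \<le> loglog (real T)"
    proof -
      have "185 / 100 \<le> ln (671/100::real)" using ln_ge_ratio[of 13 100 7 671] by simp
      also have "\<dots> \<le> ln (exp 1 + l)" using e_ge True by (subst ln_le_cancel_iff) (auto simp: add_pos_nonneg)
      finally have "4 * (185/100) \<le> l * ln (exp 1 + l)" using True by (intro mult_mono) auto
      then show ?thesis by (simp add: l_def)
    qed
    define \<kappa> where "\<kappa> = L - l"
    have "real N * (74/10) \<le> real N * loglog (real T)" using A by (intro mult_left_mono) auto
    \<comment> \<open>6 / (74/10) < 811/1000, and exp (63/100) \<ge> 1811/1000.\<close>
    then have "6 * real N \<le> (811/1000) * real T" using gt by simp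
    also have "(811/1000) * real T \<le> (exp (63/100) - 1) * real T"
      using exp_lower_Taylor_quadratic[of "63/100"] by (intro mult_right_mono) (auto simp: power2_eq_square)
    finally have "6 * real N + real T \<le> exp (63/100) * real T" by (simp add: algebra_simps)
    then have "L \<le> ln (exp (63/100) * real T)" unfolding L_def using T by (subst ln_le_cancel_iff) auto
    also have "\<dots> = 63/100 + l" using T by (subst ln_mult) (auto simp: l_def)
    finally have \<kappa>: "0 \<le> \<kappa>" "\<kappa> \<le> 63/100" using l0 by (auto simp: \<kappa>_def)
    have "J L \<le> l * ln (exp 1 + l)" using large_horizon[OF True \<kappa>] by (simp add: \<kappa>_def)
    then have "real (N - 1) * J L \<le> real N * (l * ln (exp 1 + l))"
      using l0 J_nonneg[of L] N by (intro mult_mono) auto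
    then show ?thesis by (simp add: l_def L_def)
  next
    case False
    have "T \<le> 54"
    proof -
      have "real T = exp l" using T by (simp add: l_def)
      also have "\<dots> \<le> exp 4" using False by simp
      also have "\<dots> = exp 1 ^ 4" by (simp flip: exp_of_nat_mult)
      also have "\<dots> \<le> (272/100) ^ 4" using e_less_272 by (intro power_mono) auto
      also have "\<dots> < 55" by (simp add: power_divide)
      finally show ?thesis by simp
    qed
    then have *: "real (N - 1) * L \<le> real N * l" using small_horizon[OF N T _ gt] by (simp add: l_def L_def)
    \<comment> \<open>Since N \<le> 2 (N - 1), the midpoint \<open>L / 2\<close> does not exceed
      \<open>l\<close>.\<close>
    have "real N * l \<le> real (N - 1) * (2 * l)"
      using N l0 mult_right_mono[of "real N" "2 * real (N - 1)" l] by (simp add: of_nat_diff mult_ac)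
    then have "real (N - 1) * L \<le> real (N - 1) * (2 * l)" using * by linarith
    then have L2: "L / 2 \<le> l" using N by (simp add: mult_le_cancel_left)
    have "J L \<le> L * ln (exp 1 + L / 2)" using l0 by (intro J_le_midpoint) auto
    also have "\<dots> \<le> L * ln (exp 1 + l)"
    proof (rule mult_left_mono)
      show "ln (exp 1 + L / 2) \<le> ln (exp 1 + l)"
        using l0 L2 e_plus_pos[of l] e_plus_pos[of "L / 2"] by (subst ln_le_cancel_iff) auto
    qed (use l0 in simp)
    finally have "real (N - 1) * J L \<le> real (N - 1) * (L * ln (exp 1 + l))" by (intro mult_left_mono) auto
    also have "\<dots> = (real (N - 1) * L) * ln (exp 1 + l)" by simp
    also have "\<dots> \<le> (real N * l) * ln (exp 1 + l)" using * G by (intro mult_right_mono) auto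
    finally show ?thesis by (simp add: l_def L_def mult_ac)
  qed
qed

section \<open>Sampling the leader and the played arm\<close>

abbreviation (input) unif :: "real measure" where
  "unif \<equiv> uniform_measure lborel {0..1}"

lemma prob_space_unif: "prob_space unif"
  by (rule prob_space_uniform_measure) auto

lemma measure_unif: "A \<in> sets borel \<Longrightarrow> measure unif A = measure lborel ({0..1} \<inter> A)"
  by (subst measure_uniform_measure) auto

lemma leader_in_leaders:
  fixes p :: "'a::{finite,linorder} \<Rightarrow> real"
  assumes "0 \<le> v" "v < 1"
  shows "leader p v \<in> leaders p"
proof -
  let ?S = "leaders p"
  have "Max (range p) \<in> range p" by (intro Max_in) auto
  then have ne: "?S \<noteq> {}" unfolding leaders_def by (metis (mono_tags, lifting) UNIV_I empty_Collect_eq imageE)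
  then have c: "0 < card ?S" by (simp add: card_gt_0_iff)
  then have "v * real (card ?S) < real (card ?S)" using assms by simp
  then have "nat \<lfloor>v * real (card ?S)\<rfloor> < card ?S"
    using assms c by (simp add: nat_less_iff floor_less_iff)
  then have "sorted_list_of_set ?S ! nat \<lfloor>v * real (card ?S)\<rfloor> \<in> set (sorted_list_of_set ?S)"
    by (intro nth_mem) simp
  then show ?thesis by (simp add: leader_def Let_def leaders_def)
qed

text \<open>The leader depends on \<open>v\<close> only through an integer, the floor.\<close>

lemma leader_sets [measurable]: "{v. leader p v = s} \<in> sets borel"
proof -
  let ?k = "card {a. p a = Max (range p)}"
  have "(\<lambda>v. \<lfloor>v * real ?k\<rfloor>) \<in> measurable borel (count_space UNIV)" by measurable
  moreover have "{v. leader p v = s} = (\<lambda>v. \<lfloor>v * real ?k\<rfloor>) -`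
      {m. sorted_list_of_set {a. p a = Max (range p)} ! nat m = s} \<inter> space borel"
    by (auto simp: leader_def Let_def)
  ultimately show ?thesis by simp
qed

text \<open>\<open>pick\<close> depends on \<open>u\<close> only through the set of arms whose
  cumulative sum exceeds \<open>u\<close>, and there are finitely many such sets.\<close>

lemma pick_sets [measurable]:
  fixes p :: "'a::{finite,linorder} \<Rightarrow> real"
  shows "{u. pick p u = i} \<in> sets borel"
proof -
  let ?c = "\<lambda>a. \<Sum>b\<in>{..a}. p b"
  have "{u. {a. u < ?c a} = A} \<in> sets borel" for A
  proof -
    have "{u. {a. u < ?c a} = A} = {u\<in>space borel. \<forall>a\<in>UNIV. (u < ?c a) = (a \<in> A)}" by auto
    also have "\<dots> \<in> sets borel" by measurable
    finally show ?thesis .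
  qed
  then have "(\<Union>A\<in>{A. (LEAST a. a \<in> A) = i}. {u. {a. u < ?c a} = A}) \<in> sets borel"
    by (intro sets.finite_UN) auto
  also have "(\<Union>A\<in>{A. (LEAST a. a \<in> A) = i}. {u. {a. u < ?c a} = A}) = {u. pick p u = i}"
    by (auto simp: pick_def)
  finally show ?thesis .
qed

lemma pick_eqI:
  fixes p :: "'a::{finite,linorder} \<Rightarrow> real"
  assumes "\<And>a. 0 \<le> p a" "(\<Sum>b\<in>{..<i}. p b) \<le> u" "u < (\<Sum>b\<in>{..i}. p b)"
  shows "pick p u = i"
  unfolding pick_def
proof (rule Least_equality)
  fix y assume y: "u < (\<Sum>b\<in>{..y}. p b)"
  show "i \<le> y"
  proof (rule ccontr)
    assume "\<not> i \<le> y"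
    then have "(\<Sum>b\<in>{..y}. p b) \<le> (\<Sum>b\<in>{..<i}. p b)" using assms(1) by (intro sum_mono2) auto
    then show False using y assms by simp
  qed
qed (use assms in auto)

text \<open>Only \<ge> is checked for each arm, on its interval of length \<open>p i\<close>. Both
  sides sum to 1, so all the inequalities are equalities.\<close>

lemma measure_pick:
  fixes p :: "'a::{finite,linorder} \<Rightarrow> real"
  assumes p: "p \<in> open_simplex"
  shows "measure unif {u. pick p u = i} = p i"
proof -
  interpret U: prob_space unif by (rule prob_space_unif)
  have pos: "0 \<le> p a" for a using open_simplexD(1)[OF p, of a] by simp
  have ge: "p i \<le> measure unif {u. pick p u = i}" for i
  proof -
    let ?l = "\<Sum>b\<in>{..<i}. p b"
    have eq: "(\<Sum>b\<in>{..i}. p b) = ?l + p i"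
      by (subst ivl_disj_un(2)[symmetric]) simp
    have "(\<Sum>b\<in>{..i}. p b) \<le> sum p UNIV" using pos by (intro sum_mono2) auto
    then have le: "?l + p i \<le> 1" using eq open_simplexD(3)[OF p] by simp
    have "p i = measure lborel {?l..<?l + p i}" using pos by simp
    also have "\<dots> = measure lborel ({0..1} \<inter> {?l..<?l + p i})"
    proof -
      have "0 \<le> ?l" using pos by (intro sum_nonneg) auto
      then have "{0..1} \<inter> {?l..<?l + p i} = {?l..<?l + p i}" using le by auto
      then show ?thesis by simp
    qed
    also have "\<dots> = measure unif {?l..<?l + p i}" by (simp add: measure_unif)
    also have "\<dots> \<le> measure unif {u. pick p u = i}"
      using eq pos by (intro U.finite_measure_mono) (auto intro!: pick_eqI)
    finally show ?thesis .
  qed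
  have "(\<Sum>i\<in>UNIV. measure unif {u. pick p u = i}) = measure unif (\<Union>i\<in>UNIV. {u. pick p u = i})"
    by (intro U.finite_measure_finite_Union[symmetric]) (auto simp: disjoint_family_on_def)
  also have "(\<Union>i\<in>UNIV. {u. pick p u = i}) = space unif" by auto
  finally have "(\<Sum>i\<in>UNIV. measure unif {u. pick p u = i}) = (\<Sum>i\<in>UNIV. p i)"
    using U.prob_space open_simplexD(3)[OF p] by simp
  then have "(\<Sum>i\<in>UNIV. measure unif {u. pick p u = i} - p i) = 0" by (simp add: sum_subtractf)
  then show ?thesis using ge by (subst (asm) sum_nonneg_eq_0_iff) (auto simp: algebra_simps)
qed

definition leader_prob :: "('a::{finite,linorder} \<Rightarrow> real) \<Rightarrow> 'a \<Rightarrow> real" where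
  "leader_prob p s = measure unif {v. leader p v = s}"

lemma leader_prob_nonneg: "0 \<le> leader_prob p s"
  by (simp add: leader_prob_def)

lemma sum_leader_prob: "(\<Sum>s\<in>UNIV. leader_prob p s) = 1"
proof -
  interpret U: prob_space unif by (rule prob_space_unif)
  have "(\<Sum>s\<in>UNIV. leader_prob p s) = measure unif (\<Union>s\<in>UNIV. {v. leader p v = s})"
    unfolding leader_prob_def
    by (intro U.finite_measure_finite_Union[symmetric]) (auto simp: disjoint_family_on_def)
  also have "(\<Union>s\<in>UNIV. {v. leader p v = s}) = space unif" by auto
  finally show ?thesis using U.prob_space by simp
qed

text \<open>Within [0, 1] only v = 1 can yield a non-maximizer, since the index then leaves the
  list; this is a null set.\<close>

lemma leader_prob_eq_0:
  assumes "s \<notin> leaders p"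
  shows "leader_prob p s = 0"
proof -
  have "{0..1} \<inter> {v. leader p v = s} \<subseteq> {1::real}"
    using assms leader_in_leaders[of _ p] by force
  then have "measure lborel ({0..1} \<inter> {v. leader p v = s}) \<le> measure lborel {1::real}"
    by (intro measure_mono_fmeasurable) (auto intro: sets.Int fmeasurable_compact)
  then have "measure lborel ({0..1} \<inter> {v. leader p v = s}) = 0"
    using measure_nonneg[of lborel "{0..1} \<inter> {v. leader p v = s}"] by simp
  then show ?thesis by (simp add: leader_prob_def measure_unif)
qed

section \<open>The driving noise\<close>

fun noise_time :: "'a noise \<Rightarrow> nat" where
  "noise_time (Rew a t) = t"
| "noise_time (Sel t) = t"
| "noise_time (Tie t) = t"

definition past :: "nat \<Rightarrow> 'a noise set" where
  "past t = {n. noise_time n < t}"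

text \<open>Rewards of arms not played have factor 0, so for rewards in {0, 1} a single bit decides
  the update.\<close>

lemma samba_step_played:
  "samba_step \<alpha> p s i R = samba_step \<alpha> p s i (\<lambda>_. R i)"
proof -
  have *: "(if i = b then 1 else 0) * R b = (if i = b then 1 else 0) * R i" for b by auto
  show ?thesis unfolding samba_step_def Let_def * ..
qed

lemma samba_proc_cong:
  assumes "\<And>n. noise_time n < t \<Longrightarrow> X n \<omega> = Y n \<eta>"
  shows "samba_proc \<alpha> p0 X t \<omega> = samba_proc \<alpha> p0 Y t \<eta>"
  using assms by (induction t) (simp_all add: Let_def)

text \<open>State, leader, arm and one reward bit determine a step, so ranges stay finite and level
  sets are finite unions. \<open>Y\<close> and \<open>L\<close> are general to cover both
  \<open>X\<close> on \<open>M\<close> and the coordinates of a product space.\<close>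

lemma samba_proc_measurable:
  fixes Y :: "'a::{finite,linorder} noise \<Rightarrow> 'b \<Rightarrow> real"
  assumes "\<And>n. noise_time n < t \<Longrightarrow> Y n \<in> borel_measurable L"
    and Y01: "\<And>a u \<omega>. Y (Rew a u) \<omega> \<in> {0, 1}"
  shows "\<exists>S. finite S \<and> (\<forall>\<omega>. samba_proc \<alpha> p0 Y t \<omega> \<in> S) \<and>
    (\<forall>x. {\<omega>\<in>space L. samba_proc \<alpha> p0 Y t \<omega> = x} \<in> sets L)"
  using assms(1)
proof (induction t)
  case 0
  then show ?case by (intro exI[of _ "{p0}"]) auto
next
  case (Suc t)
  let ?P = "samba_proc \<alpha> p0 Y" and ?R = "\<lambda>b _. of_bool b"
  have "\<exists>S. finite S \<and> (\<forall>\<omega>. ?P t \<omega> \<in> S) \<and> (\<forall>x. {\<omega>\<in>space L. ?P t \<omega> = x} \<in> sets L)"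
    using Suc by simp
  then obtain S where S: "finite S" "\<And>\<omega>. ?P t \<omega> \<in> S" and meas: "\<And>x. {\<omega>\<in>space L. ?P t \<omega> = x} \<in> sets L"
    by auto
  have [measurable]: "Y (Tie t) \<in> borel_measurable L" "Y (Sel t) \<in> borel_measurable L"
    "Y (Rew a t) \<in> borel_measurable L" for a using Suc.prems by auto
  have step: "?P (Suc t) \<omega> = samba_step \<alpha> p s i (?R b)"
    if "?P t \<omega> = p" "leader p (Y (Tie t) \<omega>) = s" "pick p (Y (Sel t) \<omega>) = i" "(Y (Rew i t) \<omega> = 1) = b" for \<omega> p s i b
  proof -
    have "Y (Rew i t) \<omega> = of_bool b" using that(4) Y01[of i t \<omega>] by auto
    then show ?thesis using that samba_step_played[of \<alpha> p s i "\<lambda>a. Y (Rew a t) \<omega>"] by (simp add: Let_def)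
  qed
  let ?S = "(\<lambda>(p, s, i, b). samba_step \<alpha> p s i (?R b)) ` (S \<times> UNIV \<times> UNIV \<times> UNIV)"
  have "?P (Suc t) \<omega> \<in> ?S" for \<omega>
    by (rule image_eqI[where x = "(?P t \<omega>, leader (?P t \<omega>) (Y (Tie t) \<omega>), pick (?P t \<omega>) (Y (Sel t) \<omega>),
        Y (Rew (pick (?P t \<omega>) (Y (Sel t) \<omega>)) t) \<omega> = 1)"])
      (use S(2)[of \<omega>] step[OF refl refl refl refl, of \<omega>] in auto)
  moreover have "{\<omega>\<in>space L. ?P (Suc t) \<omega> = x} \<in> sets L" for x
  proof -
    let ?E = "\<lambda>p s i b. {\<omega>\<in>space L. ?P t \<omega> = p} \<inter> (Y (Tie t) -` {v. leader p v = s} \<inter> space L)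
       \<inter> (Y (Sel t) -` {u. pick p u = i} \<inter> space L) \<inter> {\<omega>\<in>space L. (Y (Rew i t) \<omega> = 1) = b}"
    have "{\<omega>\<in>space L. ?P (Suc t) \<omega> = x} =
      (\<Union>(p, s, i, b)\<in>{(p, s, i, b)\<in>S \<times> UNIV \<times> UNIV \<times> UNIV. samba_step \<alpha> p s i (?R b) = x}. ?E p s i b)"
      (is "?A = ?B")
    proof (intro equalityI subsetI)
      fix \<omega> assume \<omega>: "\<omega> \<in> ?A"
      let ?p = "?P t \<omega>" 
      let ?s = "leader ?p (Y (Tie t) \<omega>)" and ?i = "pick ?p (Y (Sel t) \<omega>)"
      let ?b = "Y (Rew ?i t) \<omega> = 1"
      have "\<omega> \<in> ?E ?p ?s ?i ?b" "samba_step \<alpha> ?p ?s ?i (?R ?b) = x"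
        using \<omega> step[OF refl refl refl refl, of \<omega>] by auto
      then show "\<omega> \<in> ?B" using S(2)[of \<omega>] by blast
    next
      fix \<omega> assume "\<omega> \<in> ?B"
      then obtain p s i b where *: "samba_step \<alpha> p s i (?R b) = x" "\<omega> \<in> ?E p s i b" by blast
      then have "?P (Suc t) \<omega> = samba_step \<alpha> p s i (?R b)" by (intro step) simp_all
      then show "\<omega> \<in> ?A" using * by simp
    qed
    also have "\<dots> \<in> sets L"
    proof (rule sets.finite_UN)
      show "finite {(p, s, i, b)\<in>S \<times> UNIV \<times> UNIV \<times> UNIV. samba_step \<alpha> p s i (?R b) = x}"
        by (rule finite_subset[of _ "S \<times> UNIV \<times> UNIV \<times> UNIV"]) (use S(1) in auto)
      have "?E p s i b \<in> sets L" for p s i b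
        by (intro sets.Int meas measurable_sets[of _ L borel] leader_sets pick_sets) measurable
      then show "(case c of (p, s, i, b) \<Rightarrow> ?E p s i b) \<in> sets L" for c by (auto split: prod.splits)
    qed
    finally show ?thesis .
  qed
  moreover have "finite ?S" using S by auto
  ultimately show ?case by blast
qed

section \<open>The SAMBA process\<close>

declare samba_proc.simps(2) [simp del]

lemma sum_UNIV_single:
  fixes h :: "'a::finite \<Rightarrow> real"
  assumes "\<And>b. b \<noteq> a \<Longrightarrow> h b = 0"
  shows "(\<Sum>b\<in>UNIV. h b) = h a"
  using assms by (simp add: sum.remove[of UNIV a])

locale samba = prob_space M for M :: "'w measure" +
  fixes X :: "'a::{finite,linorder} noise \<Rightarrow> 'w \<Rightarrow> real"
    and r :: "'a \<Rightarrow> real" and astar :: 'a and p0 :: "'a \<Rightarrow> real" and \<beta> :: real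
  assumes card: "2 \<le> CARD('a)"
    and r: "0 \<le> r a" "r a \<le> 1"
    and best: "a \<noteq> astar \<Longrightarrow> r a < r astar"
    and p0: "p0 \<in> open_simplex"
    and \<beta>: "0 < \<beta>" "\<beta> \<le> 1"
    and indep: "indep_vars (\<lambda>_. borel) X UNIV"
    and Rew_01: "X (Rew a t) \<omega> \<in> {0, 1}"
    and Rew: "prob {\<omega>\<in>space M. X (Rew a t) \<omega> = 1} = r a"
    and Sel: "distr M borel (X (Sel t)) = unif"
    and Tie: "distr M borel (X (Tie t)) = unif"
begin

abbreviation P :: "nat \<Rightarrow> 'w \<Rightarrow> 'a \<Rightarrow> real" where
  "P \<equiv> samba_proc (samba_alpha \<beta>) p0 X"

lemma X_measurable [measurable]: "X n \<in> borel_measurable M"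
  using indep by (simp add: indep_vars_def)

lemma Sel_prob: "A \<in> sets borel \<Longrightarrow> prob (X (Sel t) -` A \<inter> space M) = measure unif A"
  using measure_distr[of "X (Sel t)" M borel A] by (simp add: Sel)

lemma Tie_prob: "A \<in> sets borel \<Longrightarrow> prob (X (Tie t) -` A \<inter> space M) = measure unif A"
  using measure_distr[of "X (Tie t)" M borel A] by (simp add: Tie)

lemma AE_Tie: "AE \<omega> in M. \<forall>t. 0 \<le> X (Tie t) \<omega> \<and> X (Tie t) \<omega> < 1"
proof (subst AE_all_countable, intro allI)
  fix t
  have "{0..1} \<inter> {0..<1} = {0..<1::real}" by auto
  then have "prob (X (Tie t) -` {0..<1} \<inter> space M) = 1" by (subst Tie_prob) (auto simp: measure_unif)
  then have "AE \<omega> in M. \<omega> \<in> X (Tie t) -` {0..<1} \<inter> space M" by (intro AE_in_set_eq_1[THEN iffD2]) auto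
  then show "AE \<omega> in M. 0 \<le> X (Tie t) \<omega> \<and> X (Tie t) \<omega> < 1" by eventually_elim auto
qed

lemma P_Suc:
  assumes "P t \<omega> = x" "x \<in> open_simplex" "leader x (X (Tie t) \<omega>) = s" "pick x (X (Sel t) \<omega>) = i"
  shows "P (Suc t) \<omega> = (if X (Rew i t) \<omega> = 1 then play \<beta> x s i else x)"
  using assms Rew_01[of i t \<omega>] samba_step_reward[of "\<lambda>a. X (Rew a t) \<omega>" i \<beta> x s]
    samba_step_no_reward[of x "\<lambda>a. X (Rew a t) \<omega>" i "samba_alpha \<beta>" s] open_simplexD(3)[of x]
  by (auto simp: Let_def samba_proc.simps(2))

lemma P_in_open_simplex:
  assumes "\<And>t. 0 \<le> X (Tie t) \<omega> \<and> X (Tie t) \<omega> < 1"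
  shows "P t \<omega> \<in> open_simplex"
proof (induction t)
  case 0
  then show ?case using p0 by simp
next
  case (Suc t)
  then show ?case
    using P_Suc[OF refl Suc refl refl] assms[of t] play_in_open_simplex[OF \<beta> Suc leader_in_leaders] by auto
qed

lemma AE_P_in_open_simplex: "AE \<omega> in M. \<forall>t. P t \<omega> \<in> open_simplex"
  using AE_Tie by eventually_elim (auto intro: P_in_open_simplex)

section \<open>Finitely many states at each time, and expectations as finite sums\<close>

lemma P_finite_range: "\<exists>S. finite S \<and> (\<forall>\<omega>. P t \<omega> \<in> S)"
  and P_sets [measurable]: "{\<omega>\<in>space M. P t \<omega> = x} \<in> sets M"
  using samba_proc_measurable[of t X M "samba_alpha \<beta>" p0] Rew_01 by auto

definition states :: "nat \<Rightarrow> ('a \<Rightarrow> real) set" where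
  "states t = (SOME S. finite S \<and> (\<forall>\<omega>. P t \<omega> \<in> S))"

lemma finite_states: "finite (states t)" and P_in_states: "P t \<omega> \<in> states t"
  using someI_ex[OF P_finite_range[of t]] unfolding states_def by auto

lemma prob_P_eq_0:
  assumes "x \<notin> open_simplex"
  shows "prob {\<omega>\<in>space M. P t \<omega> = x} = 0"
proof -
  have "AE \<omega> in M. \<omega> \<notin> {\<omega>\<in>space M. P t \<omega> = x}"
    using AE_P_in_open_simplex by eventually_elim (use assms in auto)
  then show ?thesis by (subst prob_eq_0) auto
qed

text \<open>\<open>h\<close> may still depend on \<omega>, so that the next noise can be integrated
  after fixing the current state.\<close>

lemma sum_over_states:
  "h (P t \<omega>) \<omega> = (\<Sum>x\<in>states t. indicat_real {\<omega>. P t \<omega> = x} \<omega> * h x \<omega>)"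
proof -
  have "(\<Sum>x\<in>states t. indicat_real {\<omega>. P t \<omega> = x} \<omega> * h x \<omega>) = (\<Sum>x\<in>{P t \<omega>}. indicat_real {\<omega>. P t \<omega> = x} \<omega> * h x \<omega>)"
    using finite_states P_in_states by (intro sum.mono_neutral_right) (auto simp: indicator_def)
  then show ?thesis by simp
qed

lemma has_bochner_integral_P:
  fixes f :: "('a \<Rightarrow> real) \<Rightarrow> real"
  shows "has_bochner_integral M (\<lambda>\<omega>. f (P t \<omega>)) (\<Sum>x\<in>states t. prob {\<omega>\<in>space M. P t \<omega> = x} * f x)"
proof -
  have "has_bochner_integral M (\<lambda>\<omega>. \<Sum>x\<in>states t. indicat_real {\<omega>\<in>space M. P t \<omega> = x} \<omega> * f x)
      (\<Sum>x\<in>states t. prob {\<omega>\<in>space M. P t \<omega> = x} * f x)"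
    by (intro has_bochner_integral_sum has_bochner_integral_mult_left has_bochner_integral_real_indicator)
      (auto simp: less_top[symmetric])
  moreover have "(\<Sum>x\<in>states t. indicat_real {\<omega>\<in>space M. P t \<omega> = x} \<omega> * f x) = f (P t \<omega>)" if "\<omega> \<in> space M" for \<omega>
    unfolding sum_over_states[of "\<lambda>x _. f x" t \<omega>] using that by (intro sum.cong) (auto simp: indicator_def)
  ultimately show ?thesis by (subst has_bochner_integral_cong) auto
qed

lemma integrable_P [simp, intro]: "integrable M (\<lambda>\<omega>. f (P t \<omega>) :: real)"
  using has_bochner_integral_P by (rule integrable.intros)

lemma expectation_P: "expectation (\<lambda>\<omega>. f (P t \<omega>)) = (\<Sum>x\<in>states t. prob {\<omega>\<in>space M. P t \<omega> = x} * f x)"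
  using has_bochner_integral_P by (rule has_bochner_integral_integral_eq)

lemma borel_measurable_P [measurable]: "(\<lambda>\<omega>. f (P t \<omega>) :: real) \<in> borel_measurable M"
  using integrable_P[of f t] by (rule borel_measurable_integrable)

section \<open>Independence of the past from the present noise\<close>

definition past_event :: "nat \<Rightarrow> 'w set \<Rightarrow> bool" where
  "past_event t E \<longleftrightarrow> (\<exists>B\<in>sets (PiM (past t) (\<lambda>_. borel)).
     E = (\<lambda>\<omega>. restrict (\<lambda>n. X n \<omega>) (past t)) -` B \<inter> space M)"

lemma past_event_sets: "past_event t E \<Longrightarrow> E \<in> sets M"
  unfolding past_event_def by (auto intro!: measurable_sets[OF measurable_restrict])

text \<open>The indices before \<open>t\<close> and the three indices in \<open>now\<close> are
  disjoint blocks: block independence splits off \<open>E\<close>, mutual independence factors the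
  rest.\<close>

lemma past_event_indep:
  assumes E: "past_event t E" and A: "A1 \<in> sets borel" "A2 \<in> sets borel" "A3 \<in> sets borel"
  shows "prob (E \<inter> (X (Tie t) -` A1 \<inter> space M) \<inter> (X (Sel t) -` A2 \<inter> space M) \<inter> (X (Rew i t) -` A3 \<inter> space M))
    = prob E * (measure unif A1 * measure unif A2 * prob (X (Rew i t) -` A3 \<inter> space M))"
proof -
  obtain B where B: "B \<in> sets (PiM (past t) (\<lambda>_. borel))"
    and E_eq: "E = (\<lambda>\<omega>. restrict (\<lambda>n. X n \<omega>) (past t)) -` B \<inter> space M"
    using E unfolding past_event_def by auto
  define now :: "'a noise set" where "now = {Tie t, Sel t, Rew i t}"
  \<comment> \<open>One target set for each kind of noise, so that the present event is the box
    \<open>PiE now C\<close>.\<close>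
  define C where "C = (\<lambda>n :: 'a noise. case n of Tie _ \<Rightarrow> A1 | Sel _ \<Rightarrow> A2 | Rew _ _ \<Rightarrow> A3)"
  have C: "C n \<in> sets borel" for n using A by (cases n) (auto simp: C_def)
  have fin: "finite now" by (simp add: now_def)
  let ?now = "(\<lambda>\<omega>. restrict (\<lambda>n. X n \<omega>) now) -` PiE now C \<inter> space M"
  have now_eq: "?now = (\<Inter>n\<in>now. X n -` C n \<inter> space M)"
    by (auto simp: now_def PiE_def)
  have "prob ((\<lambda>\<omega>. (restrict (\<lambda>n. X n \<omega>) (past t), restrict (\<lambda>n. X n \<omega>) now)) -` (B \<times> PiE now C) \<inter> space M)
     = prob E * prob ?now"
    unfolding E_eq
  proof (rule indep_varD)
    show "indep_var (PiM (past t) (\<lambda>_. borel)) (\<lambda>\<omega>. restrict (\<lambda>n. X n \<omega>) (past t))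
        (PiM now (\<lambda>_. borel)) (\<lambda>\<omega>. restrict (\<lambda>n. X n \<omega>) now)"
      using indep by (rule indep_var_restrict) (auto simp: past_def now_def)
    show "PiE now C \<in> sets (PiM now (\<lambda>_. borel))" using fin C by (intro sets_PiM_I_finite) auto
  qed (rule B)
  also have "prob ?now = (\<Prod>n\<in>now. prob (X n -` C n \<inter> space M))"
    unfolding now_eq using C fin by (intro indep_varsD[OF indep]) (auto simp: now_def)
  also have "\<dots> = measure unif A1 * measure unif A2 * prob (X (Rew i t) -` A3 \<inter> space M)"
    using A by (simp add: now_def C_def Tie_prob Sel_prob)
  also have "(\<lambda>\<omega>. (restrict (\<lambda>n. X n \<omega>) (past t), restrict (\<lambda>n. X n \<omega>) now)) -` (B \<times> PiE now C) \<inter> space M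
     = E \<inter> (X (Tie t) -` A1 \<inter> space M) \<inter> (X (Sel t) -` A2 \<inter> space M) \<inter> (X (Rew i t) -` A3 \<inter> space M)"
  proof -
    have "(\<lambda>\<omega>. (restrict (\<lambda>n. X n \<omega>) (past t), restrict (\<lambda>n. X n \<omega>) now)) -` (B \<times> PiE now C) \<inter> space M = E \<inter> ?now"
      unfolding E_eq by auto
    also have "\<dots> = E \<inter> (X (Tie t) -` A1 \<inter> space M) \<inter> (X (Sel t) -` A2 \<inter> space M) \<inter> (X (Rew i t) -` A3 \<inter> space M)"
      unfolding now_eq by (auto simp: now_def C_def)
    finally show ?thesis .
  qed
  finally show ?thesis .
qed

text \<open>Up to time \<open>t\<close> the process reads only noise before \<open>t\<close>, so it
  can be run on the coordinates of the product space. \<open>A\<close> selects the times: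
  \<open>UNIV\<close> for the Markov property, \<open>{t}\<close> for a single state.\<close>

lemma past_event_history: "past_event t {\<omega>\<in>space M. \<forall>s\<le>t. s \<in> A \<longrightarrow> P s \<omega> = xs s}"
proof -
  \<comment> \<open>On the product space the reward coordinates are arbitrary reals, so they are rounded to 0 or 1.\<close>
  define Y where "Y = (\<lambda>(n :: 'a noise) (x :: 'a noise \<Rightarrow> real).
    case n of Rew _ _ \<Rightarrow> (if x n = 1 then 1 else 0) | _ \<Rightarrow> x n)"
  let ?N = "PiM (past t) (\<lambda>_. borel) :: ('a noise \<Rightarrow> real) measure" and ?\<Phi> = "samba_proc (samba_alpha \<beta>) p0 Y"
  let ?B = "{x\<in>space ?N. \<forall>s\<le>t. s \<in> A \<longrightarrow> ?\<Phi> s x = xs s}"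
  have Ymeas: "Y n \<in> borel_measurable ?N" if "noise_time n < t" for n
  proof -
    have [measurable]: "(\<lambda>x. x n) \<in> borel_measurable ?N"
      using that by (intro measurable_component_singleton) (simp add: past_def)
    have "(\<lambda>x. if x n = 1 then 1 else 0 :: real) \<in> borel_measurable ?N" by measurable
    moreover have "Y n = (\<lambda>x. if x n = 1 then 1 else 0) \<or> Y n = (\<lambda>x. x n)" by (cases n) (auto simp: Y_def)
    ultimately show ?thesis using \<open>(\<lambda>x. x n) \<in> borel_measurable ?N\<close> by metis
  qed
  have "{x\<in>space ?N. ?\<Phi> s x = xs s} \<in> sets ?N" if "s \<le> t" for s
  proof -
    have "Y (Rew a u) x \<in> {0, 1}" for a u x by (simp add: Y_def)
    then have "\<exists>S. finite S \<and> (\<forall>x. ?\<Phi> s x \<in> S) \<and> (\<forall>y. {x\<in>space ?N. ?\<Phi> s x = y} \<in> sets ?N)"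
      using that by (intro samba_proc_measurable Ymeas) auto
    then show ?thesis by blast
  qed
  then have "{x\<in>space ?N. s \<in> A \<longrightarrow> ?\<Phi> s x = xs s} \<in> sets ?N" if "s \<le> t" for s
    using that by (cases "s \<in> A") auto
  then have "{x\<in>space ?N. \<forall>s\<in>{..t}. s \<in> A \<longrightarrow> ?\<Phi> s x = xs s} \<in> sets ?N"
    by (intro sets.sets_Collect_finite_All) auto
  then have B: "?B \<in> sets ?N" by (simp only: Ball_def atMost_iff)
  have "?\<Phi> s (restrict (\<lambda>n. X n \<omega>) (past t)) = P s \<omega>" if "s \<le> t" for s \<omega>
  proof (rule samba_proc_cong)
    fix n :: "'a noise" assume "noise_time n < s"
    then have "n \<in> past t" using that by (simp add: past_def)
    then show "Y n (restrict (\<lambda>n. X n \<omega>) (past t)) = X n \<omega>"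
    proof (cases n)
      case (Rew a u)
      then show ?thesis using \<open>n \<in> past t\<close> Rew_01[of a u \<omega>] by (auto simp: Y_def)
    qed (simp_all add: Y_def)
  qed
  then have "{\<omega>\<in>space M. \<forall>s\<le>t. s \<in> A \<longrightarrow> P s \<omega> = xs s} = (\<lambda>\<omega>. restrict (\<lambda>n. X n \<omega>) (past t)) -` ?B \<inter> space M"
    by (auto simp: space_PiM)
  then show ?thesis using B unfolding past_event_def by blast
qed

lemma past_event_P: "past_event t {\<omega>\<in>space M. P t \<omega> = x}"
  using past_event_history[of t "{t}" "\<lambda>_. x"] by simp

text \<open>Given the past, the noise at time \<open>t\<close> is fresh, so leader \<open>s\<close>,
  arm \<open>i\<close> and success occur together with probability
  \<open>leader_prob x s * x i * r i\<close>; a failure leaves \<open>x\<close> unchanged.\<close>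

lemma expectation_step:
  assumes E: "past_event t E" "\<And>\<omega>. \<omega> \<in> E \<Longrightarrow> P t \<omega> = x" and x: "x \<in> open_simplex"
  shows "expectation (\<lambda>\<omega>. indicat_real E \<omega> * f (P (Suc t) \<omega>))
    = prob E * (\<Sum>s\<in>UNIV. leader_prob x s * (f x + drift \<beta> r f x s))"
proof -
  define F where "F = (\<lambda>s i. E \<inter> (X (Tie t) -` {v. leader x v = s} \<inter> space M) \<inter> (X (Sel t) -` {u. pick x u = i} \<inter> space M)
     \<inter> (X (Rew i t) -` {1} \<inter> space M))"
  have E_sets [measurable]: "E \<in> sets M" using past_event_sets E by simp
  have F_sets: "F s i \<in> sets M" for s i
    unfolding F_def by (intro sets.Int measurable_sets[OF X_measurable] leader_sets pick_sets E_sets) auto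
  have F_prob: "prob (F s i) = prob E * (leader_prob x s * x i * r i)" for s i
  proof -
    have "prob (X (Rew i t) -` {1} \<inter> space M) = r i"
      using Rew[of i t] by (simp add: vimage_def Int_def conj_commute)
    then show ?thesis unfolding F_def
      by (subst past_event_indep[OF E(1)]) (auto simp: leader_prob_def measure_pick[OF x])
  qed
  have split: "indicat_real E \<omega> * f (P (Suc t) \<omega>) = indicat_real E \<omega> * f x +
      (\<Sum>s\<in>UNIV. \<Sum>i\<in>UNIV. indicat_real (F s i) \<omega> * (f (play \<beta> x s i) - f x))" if "\<omega> \<in> space M" for \<omega>
  proof (cases "\<omega> \<in> E")
    case False
    then show ?thesis by (simp add: F_def)
  next
    case True
    let ?s = "leader x (X (Tie t) \<omega>)" and ?i = "pick x (X (Sel t) \<omega>)"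
    \<comment> \<open>Only the actual leader and the actual arm contribute, so the double sum has a
      single term.\<close>
    have F: "indicat_real (F s i) \<omega> = 0" if "s \<noteq> ?s \<or> i \<noteq> ?i" for s i
      using that by (auto simp: F_def indicator_def)
    have "(\<Sum>s\<in>UNIV. \<Sum>i\<in>UNIV. indicat_real (F s i) \<omega> * (f (play \<beta> x s i) - f x))
        = (\<Sum>i\<in>UNIV. indicat_real (F ?s i) \<omega> * (f (play \<beta> x ?s i) - f x))"
      by (rule sum_UNIV_single) (simp add: F)
    also have "\<dots> = indicat_real (F ?s ?i) \<omega> * (f (play \<beta> x ?s ?i) - f x)"
      by (rule sum_UNIV_single) (simp add: F)
    also have "\<dots> = (if X (Rew ?i t) \<omega> = 1 then f (play \<beta> x ?s ?i) - f x else 0)"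
      using True that by (simp add: F_def)
    finally show ?thesis using True P_Suc[OF E(2)[OF True] x refl refl] by simp
  qed
  have "has_bochner_integral M (\<lambda>\<omega>. indicat_real E \<omega> * f x +
      (\<Sum>s\<in>UNIV. \<Sum>i\<in>UNIV. indicat_real (F s i) \<omega> * (f (play \<beta> x s i) - f x)))
      (prob E * f x + (\<Sum>s\<in>UNIV. \<Sum>i\<in>UNIV. prob (F s i) * (f (play \<beta> x s i) - f x)))"
    by (intro has_bochner_integral_add has_bochner_integral_sum has_bochner_integral_mult_left
        has_bochner_integral_real_indicator F_sets E_sets) (auto simp: less_top[symmetric])
  then have "has_bochner_integral M (\<lambda>\<omega>. indicat_real E \<omega> * f (P (Suc t) \<omega>))
      (prob E * f x + (\<Sum>s\<in>UNIV. \<Sum>i\<in>UNIV. prob (F s i) * (f (play \<beta> x s i) - f x)))"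
    using split by (subst has_bochner_integral_cong) auto
  then have "expectation (\<lambda>\<omega>. indicat_real E \<omega> * f (P (Suc t) \<omega>))
    = prob E * f x + (\<Sum>s\<in>UNIV. \<Sum>i\<in>UNIV. prob (F s i) * (f (play \<beta> x s i) - f x))"
    by (rule has_bochner_integral_integral_eq)
  also have "(\<Sum>s\<in>UNIV. \<Sum>i\<in>UNIV. prob (F s i) * (f (play \<beta> x s i) - f x))
      = prob E * (\<Sum>s\<in>UNIV. leader_prob x s * drift \<beta> r f x s)"
    unfolding F_prob drift_def by (simp add: sum_distrib_left mult_ac)
  also have "prob E * f x = prob E * (\<Sum>s\<in>UNIV. leader_prob x s * f x)"
    using sum_leader_prob[of x] by (simp flip: sum_distrib_right)
  finally show ?thesis by (simp add: distrib_left sum.distrib)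
qed

text \<open>Sum the one-step formula over the current states; non-leaders \<open>s\<close> and
  states outside the simplex have probability 0.\<close>

lemma expectation_drift_le:
  assumes "\<And>p s. p \<in> open_simplex \<Longrightarrow> s \<in> leaders p \<Longrightarrow> drift \<beta> r f p s \<le> g p"
  shows "expectation (\<lambda>\<omega>. f (P (Suc t) \<omega>)) \<le> expectation (\<lambda>\<omega>. f (P t \<omega>)) + expectation (\<lambda>\<omega>. g (P t \<omega>))"
proof -
  let ?E = "\<lambda>x. {\<omega>\<in>space M. P t \<omega> = x}"
  have "expectation (\<lambda>\<omega>. f (P (Suc t) \<omega>))
      = expectation (\<lambda>\<omega>. \<Sum>x\<in>states t. indicat_real (?E x) \<omega> * f (P (Suc t) \<omega>))"
    by (intro Bochner_Integration.integral_cong refl, subst sum_over_states[of "\<lambda>x \<omega>. f (P (Suc t) \<omega>)" t])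
      (auto intro!: sum.cong simp: indicator_def)
  also have "\<dots> = (\<Sum>x\<in>states t. expectation (\<lambda>\<omega>. indicat_real (?E x) \<omega> * f (P (Suc t) \<omega>)))"
    using integrable_real_mult_indicator[OF P_sets integrable_P]
    by (intro Bochner_Integration.integral_sum) (simp add: mult.commute)
  also have "\<dots> \<le> (\<Sum>x\<in>states t. prob (?E x) * (f x + g x))"
  proof (rule sum_mono)
    fix x
    show "expectation (\<lambda>\<omega>. indicat_real (?E x) \<omega> * f (P (Suc t) \<omega>)) \<le> prob (?E x) * (f x + g x)"
    proof (cases "x \<in> open_simplex")
      case True
      have "leader_prob x s * (f x + drift \<beta> r f x s) \<le> leader_prob x s * (f x + g x)" for s
        using leader_prob_eq_0[of s x] leader_prob_nonneg[of x s] assms[OF True, of s]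
        by (cases "s \<in> leaders x") (auto intro: mult_left_mono)
      then have "(\<Sum>s\<in>UNIV. leader_prob x s * (f x + drift \<beta> r f x s)) \<le> (\<Sum>s\<in>UNIV. leader_prob x s * (f x + g x))"
        by (intro sum_mono)
      also have "\<dots> = f x + g x" using sum_leader_prob[of x] by (simp flip: sum_distrib_right)
      finally show ?thesis
        by (subst expectation_step[OF past_event_P _ True]) (auto intro: mult_left_mono)
    next
      case False
      have "AE \<omega> in M. indicat_real (?E x) \<omega> * f (P (Suc t) \<omega>) = 0"
        using AE_P_in_open_simplex by eventually_elim (use False in \<open>auto simp: indicator_def\<close>)
      then have "expectation (\<lambda>\<omega>. indicat_real (?E x) \<omega> * f (P (Suc t) \<omega>)) = 0"
        by (rule integral_eq_zero_AE)
      then show ?thesis using prob_P_eq_0[OF False] by simp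
    qed
  qed
  also have "\<dots> = expectation (\<lambda>\<omega>. f (P t \<omega>)) + expectation (\<lambda>\<omega>. g (P t \<omega>))"
    unfolding expectation_P by (simp add: distrib_left sum.distrib)
  finally show ?thesis .
qed

section \<open>The Markov property\<close>

theorem markov: "discrete_markov_chain M P"
  unfolding discrete_markov_chain_def
proof (intro conjI)
  show "\<exists>S. countable S \<and> (\<forall>t. \<forall>\<omega>\<in>space M. P t \<omega> \<in> S)"
    using finite_states P_in_states by (intro exI[of _ "\<Union>t. states t"]) (auto intro: countable_finite)
  show "\<forall>t x. {\<omega>\<in>space M. P t \<omega> = x} \<in> sets M" by simp
  \<comment> \<open>The one-step formula for the indicator of \<open>y\<close>; it does not involve
    the time.\<close>
  define K where "K = (\<lambda>x y. \<Sum>s\<in>UNIV. leader_prob x s * (indicat_real {y} x + drift \<beta> r (indicat_real {y}) x s))"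
  have "prob {\<omega>\<in>space M. \<forall>s\<le>Suc t. P s \<omega> = xs s} = prob {\<omega>\<in>space M. \<forall>s\<le>t. P s \<omega> = xs s} * K (xs t) (xs (Suc t))"
    (is "prob ?E' = prob ?E * _") for t xs
  proof -
    have E: "past_event t ?E" using past_event_history[of t UNIV xs] by simp
    have [measurable]: "?E \<in> sets M" by (rule past_event_sets[OF E])
    have E': "?E' = ?E \<inter> {\<omega>\<in>space M. P (Suc t) \<omega> = xs (Suc t)}" by (auto simp: le_Suc_eq)
    show ?thesis
    proof (cases "xs t \<in> open_simplex")
      case True
      have "prob ?E' = expectation (indicat_real ?E')" unfolding E' by simp
      also have "\<dots> = expectation (\<lambda>\<omega>. indicat_real ?E \<omega> * indicat_real {xs (Suc t)} (P (Suc t) \<omega>))"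
        unfolding E' by (intro Bochner_Integration.integral_cong) (auto simp: indicator_def)
      also have "\<dots> = prob ?E * K (xs t) (xs (Suc t))"
        unfolding K_def by (rule expectation_step[OF E _ True]) auto
      finally show ?thesis .
    next
      case False
      \<comment> \<open>A state outside the simplex is null, so both sides vanish.\<close>
      have "prob ?E \<le> prob {\<omega>\<in>space M. P t \<omega> = xs t}" by (intro finite_measure_mono) auto
      moreover have "prob ?E' \<le> prob {\<omega>\<in>space M. P t \<omega> = xs t}" by (intro finite_measure_mono) auto
      ultimately show ?thesis using prob_P_eq_0[OF False, of t] measure_nonneg[of M ?E] measure_nonneg[of M ?E'] by simp
    qed
  qed
  then show "\<exists>K. \<forall>t xs. prob {\<omega>\<in>space M. \<forall>s\<le>Suc t. P s \<omega> = xs s} =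
      prob {\<omega>\<in>space M. \<forall>s\<le>t. P s \<omega> = xs s} * K (xs t) (xs (Suc t))" by blast
qed

end

section \<open>Almost sure convergence\<close>

text \<open>Growth by at most the factor \<open>N\<close> forbids jumping from below \<epsilon> to
  near 1 when N \<epsilon> \<le> 1/2. A late visit near 0 is therefore final, and trapping at every
  smaller scale would give the limit 0.\<close>

lemma tendsto_1_if_trapped:
  fixes q :: "nat \<Rightarrow> real"
  assumes N: "1 \<le> N" and q: "\<And>t. 0 < q t" "\<And>t. q t < 1" "\<And>t. q (Suc t) \<le> N * q t"
    and trap: "\<And>\<epsilon>. 0 < \<epsilon> \<Longrightarrow> eventually (\<lambda>t. q t < \<epsilon> \<or> 1 - q t < N * \<epsilon>) sequentially"
    and no0: "\<not> q \<longlonglongrightarrow> 0"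
  shows "q \<longlonglongrightarrow> 1"
proof -
  have close: "eventually (\<lambda>t. 1 - q t < N * \<epsilon>) sequentially" if \<epsilon>: "0 < \<epsilon>" "\<epsilon> \<le> 1 / (2 * N)" for \<epsilon>
  proof (rule ccontr)
    assume not: "\<not> ?thesis"
    have N\<epsilon>: "N * \<epsilon> \<le> 1/2" using mult_left_mono[OF \<epsilon>(2), of N] N by simp
    obtain t0 where t0: "\<And>t. t0 \<le> t \<Longrightarrow> q t < \<epsilon> \<or> 1 - q t < N * \<epsilon>"
      using trap[OF \<epsilon>(1)] by (auto simp: eventually_sequentially)
    obtain t1 where t1: "t0 \<le> t1" "\<not> 1 - q t1 < N * \<epsilon>" using not by (auto simp: eventually_sequentially)
    have small: "q t < \<epsilon>" if "t1 \<le> t" for t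
      using that
    proof (induction rule: dec_induct)
      case base
      then show ?case using t0[OF t1(1)] t1(2) by auto
    next
      case (step t)
      have "q (Suc t) < N * \<epsilon>" using q(3)[of t] mult_strict_left_mono[OF step.IH, of N] N by linarith
      then show ?case using t0[of "Suc t"] t1(1) step.hyps N\<epsilon> by auto
    qed
    have "1 * \<epsilon> \<le> N * \<epsilon>" using N \<epsilon> by (intro mult_right_mono) auto
    then have \<epsilon>2: "\<epsilon> \<le> 1/2" using N\<epsilon> by linarith
    have "q \<longlonglongrightarrow> 0"
    proof (rule tendstoI)
      fix e :: real assume e: "0 < e"
      \<comment> \<open>At scale \<delta> \<le> \<epsilon> the alternative near 1 contradicts
        \<open>small\<close>, which leaves \<open>q t < \<delta>\<close>.\<close>
      define \<delta> where "\<delta> = min e \<epsilon>"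
      have \<delta>: "0 < \<delta>" "\<delta> \<le> e" "\<delta> \<le> \<epsilon>" using e \<epsilon> by (auto simp: \<delta>_def)
      have "N * \<delta> \<le> N * \<epsilon>" using \<delta> N by (intro mult_left_mono) auto
      then have N\<delta>: "N * \<delta> \<le> 1/2" using N\<epsilon> by simp
      show "eventually (\<lambda>t. dist (q t) 0 < e) sequentially"
        using trap[OF \<delta>(1)] eventually_ge_at_top[of t1]
      proof eventually_elim
        case (elim t)
        then show ?case using small[of t] q(1)[of t] N\<delta> \<delta> \<epsilon>2 by auto
      qed
    qed
    then show False using no0 by simp
  qed
  show ?thesis
  proof (rule tendstoI)
    fix e :: real assume e: "0 < e"
    define \<epsilon> where "\<epsilon> = min (e / N) (1 / (2 * N))"
    have \<epsilon>: "0 < \<epsilon>" "\<epsilon> \<le> 1 / (2 * N)" "\<epsilon> \<le> e / N" using e N by (auto simp: \<epsilon>_def)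
    have "N * \<epsilon> \<le> e" using mult_left_mono[OF \<epsilon>(3), of N] N by simp
    then have "dist (q t) 1 < e" if "1 - q t < N * \<epsilon>" for t using that q(2)[of t] by (simp add: dist_real_def abs_if)
    then show "eventually (\<lambda>t. dist (q t) 1 < e) sequentially"
      using close[OF \<epsilon>(1,2)] by (rule eventually_mono[rotated])
  qed
qed

context samba
begin

definition gap :: real where
  "gap = r astar - Max (r ` (UNIV - {astar}))"

lemma other_arm: "\<exists>b. b \<noteq> astar"
proof (rule ccontr)
  assume "\<not> ?thesis"
  then have "UNIV = {astar}" by auto
  then have "CARD('a) = 1" by (metis is_singletonI is_singleton_altdef)
  then show False using card by simp
qed

lemma gap_pos: "0 < gap" and gap: "b \<noteq> astar \<Longrightarrow> r b \<le> r astar - gap"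
proof -
  have "UNIV - {astar} \<noteq> {}" using other_arm by auto
  then have "Max (r ` (UNIV - {astar})) \<in> r ` (UNIV - {astar})" by (intro Max_in) auto
  then obtain a where "a \<noteq> astar" "Max (r ` (UNIV - {astar})) = r a" by auto
  then show "0 < gap" using best[of a] by (simp add: gap_def)
  show "b \<noteq> astar \<Longrightarrow> r b \<le> r astar - gap" by (simp add: gap_def)
qed

lemma r_le_best: "r b \<le> r astar"
  using best[of b] by (cases "b = astar") auto

lemma drift_best_nonneg:
  assumes p: "p \<in> open_simplex" and s: "s \<in> leaders p"
  shows "0 \<le> drift \<beta> r (\<lambda>p. p astar) p s"
proof (cases "s = astar")
  case True
  then show ?thesis
    using drift_leader[OF \<beta> p s, of r] r_le_best less_imp_le[OF alpha_bounds(1)[OF \<beta> p s]]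
    by (auto intro!: sum_nonneg mult_nonneg_nonneg)
next
  case False
  then show ?thesis
    using drift_not_leader[OF \<beta> p s, of astar r] r_le_best[of s] less_imp_le[OF alpha_bounds(1)[OF \<beta> p s]]
    by (auto intro!: mult_nonneg_nonneg)
qed

text \<open>Away from both ends the drift of \<open>p astar\<close> is at least \<open>c\<close>,
  while the total drift of a quantity in [0, 1] is at most 1. The probabilities of being there are
  thus summable.\<close>

lemma AE_trapped:
  assumes \<epsilon>: "0 < \<epsilon>"
  shows "AE \<omega> in M. eventually (\<lambda>t. P t \<omega> astar < \<epsilon> \<or> 1 - P t \<omega> astar < real CARD('a) * \<epsilon>) sequentially"
proof (cases "\<epsilon> \<le> 1")
  case False
  have "AE \<omega> in M. \<forall>t. P t \<omega> astar < \<epsilon>"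
    using AE_P_in_open_simplex by eventually_elim (use False open_simplexD(2) in \<open>meson le_less_trans not_le\<close>)
  then show ?thesis by eventually_elim auto
next
  case True
  define c where "c = gap * (samba_alpha \<beta> \<epsilon> * \<epsilon>\<^sup>2)"
  have c: "0 < c" using gap_pos samba_alpha_pos[OF \<beta>(1) \<epsilon> True] \<epsilon> by (simp add: c_def)
  let ?b = "\<lambda>p :: 'a \<Rightarrow> real. \<epsilon> \<le> p astar \<and> \<epsilon> \<le> (1 - p astar) / real CARD('a)"
  let ?B = "\<lambda>t. {\<omega>\<in>space M. ?b (P t \<omega>)}"
  have B_sets [measurable]: "?B t \<in> sets M" for t by measurable
  \<comment> \<open>The sign is reversed because \<open>expectation_drift_le\<close> yields upper
    bounds.\<close>
  have step: "expectation (\<lambda>\<omega>. - P (Suc t) \<omega> astar) \<le> expectation (\<lambda>\<omega>. - P t \<omega> astar) + - c * prob (?B t)" for t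
  proof -
    have "expectation (\<lambda>\<omega>. - P (Suc t) \<omega> astar) \<le> expectation (\<lambda>\<omega>. - P t \<omega> astar)
        + expectation (\<lambda>\<omega>. - c * indicat_real {p. ?b p} (P t \<omega>))"
    proof (rule expectation_drift_le[of "\<lambda>p. - p astar" "\<lambda>p. - c * indicat_real {p. ?b p} p"])
      fix p :: "'a \<Rightarrow> real" and s assume p: "p \<in> open_simplex" and s: "s \<in> leaders p"
      have "drift \<beta> r (\<lambda>p. - p astar) p s = - drift \<beta> r (\<lambda>p. p astar) p s"
        by (simp add: drift_def sum_negf[symmetric] algebra_simps)
      also have "\<dots> \<le> - c * indicat_real {p. ?b p} p"
        using drift_best_nonneg[OF p s] drift_best_ge[where r = r and a = astar, OF \<beta> p s r card gap_pos gap \<epsilon>]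
        by (auto simp: c_def indicator_def)
      finally show "drift \<beta> r (\<lambda>p. - p astar) p s \<le> - c * indicat_real {p. ?b p} p" .
    qed
    also have "expectation (\<lambda>\<omega>. - c * indicat_real {p. ?b p} (P t \<omega>)) = - c * expectation (indicat_real (?B t))"
      by (subst Bochner_Integration.integral_mult_right_zero[symmetric], intro Bochner_Integration.integral_cong)
        (auto simp: indicator_def)
    finally show ?thesis by simp
  qed
  have le1: "expectation (\<lambda>\<omega>. P t \<omega> astar) \<le> 1" for t
  proof -
    have "expectation (\<lambda>\<omega>. P t \<omega> astar) \<le> expectation (\<lambda>_. 1)"
      using integrable_P[of "\<lambda>p. p astar"]
      by (intro integral_mono_AE) (use AE_P_in_open_simplex open_simplexD(2) in \<open>auto elim!: eventually_mono\<close>)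
    then show ?thesis by (simp add: prob_space)
  qed
  have telescope: "c * (\<Sum>t<n. prob (?B t)) \<le> expectation (\<lambda>\<omega>. P n \<omega> astar) - expectation (\<lambda>\<omega>. P 0 \<omega> astar)" for n
  proof (induction n)
    case (Suc n)
    then show ?case using step[of n] by (simp add: distrib_left)
  qed simp
  have "c * (\<Sum>t<n. prob (?B t)) \<le> 1" for n
    using telescope[of n] le1[of n] open_simplexD(1)[OF p0, of astar] by (simp add: prob_space)
  then have "(\<Sum>t<n. prob (?B t)) \<le> 1 / c" for n using c by (simp add: field_simps)
  then have "summable (\<lambda>t. prob (?B t))" by (intro summableI_nonneg_bounded) auto
  then have "AE \<omega> in M. eventually (\<lambda>t. \<omega> \<in> space M - ?B t) sequentially"
    by (intro borel_cantelli_AE1 B_sets) (auto simp: less_top[symmetric])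
  then show ?thesis
  proof eventually_elim
    case (elim \<omega>)
    have N: "0 < real CARD('a)" by simp
    from elim show ?case
      by eventually_elim (use N in \<open>auto simp: not_le pos_divide_less_eq mult.commute\<close>)
  qed
qed

text \<open>Where the truncated reciprocal may grow, by at most 1 in mean, \<open>p astar\<close>
  grows by at least \<delta>; subtracting \<open>1 / \<delta> * p astar\<close>, which is bounded,
  gives a supermartingale.\<close>

lemma expectation_inverse_best_bounded: "\<exists>C. \<forall>t. expectation (\<lambda>\<omega>. 1 / P t \<omega> astar) \<le> C"
proof -
  define K where "K = max (6 * real CARD('a)) (exp (exp (2 / gap)))"
  define \<delta> where "\<delta> = gap * (samba_alpha \<beta> (1 / (2 * K)) * (1 / (2 * K))\<^sup>2)"
  define W where "W = (\<lambda>p. max (1 / p astar) K - 1 / \<delta> * p astar)"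
  have K: "6 * real CARD('a) \<le> K" "exp (exp (2 / gap)) \<le> K" by (auto simp: K_def)
  have K12: "12 \<le> K" using K(1) card by linarith
  then have x: "0 < 1 / (2 * K)" "1 / (2 * K) \<le> 1" by (auto simp: field_simps)
  have \<delta>: "0 < \<delta>" using gap_pos samba_alpha_pos[OF \<beta>(1) x] x by (simp add: \<delta>_def)
  have W: "drift \<beta> r W p s \<le> 0" if p: "p \<in> open_simplex" and s: "s \<in> leaders p" for p s
  proof -
    let ?f = "\<lambda>p. max (1 / p astar) K"
    have "drift \<beta> r W p s = drift \<beta> r ?f p s - 1 / \<delta> * drift \<beta> r (\<lambda>p. p astar) p s"
      unfolding drift_def W_def by (simp add: sum_distrib_left sum_subtractf[symmetric] algebra_simps)
    also have "\<dots> \<le> 0"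
    proof (cases "s = astar \<or> p astar < 1 / (2 * K)")
      case True
      have "drift \<beta> r ?f p s \<le> 0"
        using True drift_inverse_leader_le_0[where r = r, OF \<beta> p s r K(1)]
          drift_inverse_best_le_0[where r = r and a = astar, OF \<beta> p s r K gap_pos gap] by (cases "s = astar") auto
      moreover have "0 \<le> 1 / \<delta> * drift \<beta> r (\<lambda>p. p astar) p s"
        using drift_best_nonneg[OF p s] \<delta> by simp
      ultimately show ?thesis by linarith
    next
      case False
      \<comment> \<open>A best arm that does not lead stays away from 1 as well.\<close>
      then have "p astar \<le> 1/2" using not_leader_le_half[OF p s, of astar] by auto
      moreover have "1 / (2 * K) * real CARD('a) \<le> 1/2" using K(1) K12 by (simp add: field_simps)
      ultimately have "1 / (2 * K) * real CARD('a) \<le> 1 - p astar" by linarith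
      then have "\<delta> \<le> drift \<beta> r (\<lambda>p. p astar) p s"
        unfolding \<delta>_def using False x
        by (intro drift_best_ge[where r = r and a = astar, OF \<beta> p s r card gap_pos gap]) (auto simp: pos_le_divide_eq)
      then have "1 \<le> 1 / \<delta> * drift \<beta> r (\<lambda>p. p astar) p s" using \<delta> by (simp add: field_simps)
      then show ?thesis using drift_inverse_le_1[where r = r and a = astar, OF \<beta> p s r K(1)] by linarith
    qed
    finally show ?thesis .
  qed
  have bound: "expectation (\<lambda>\<omega>. W (P t \<omega>)) \<le> W p0" for t
  proof (induction t)
    case 0
    then show ?case by (simp add: prob_space)
  next
    case (Suc t)
    then show ?case using expectation_drift_le[of W "\<lambda>_. 0" t] W by simp
  qed
  have "expectation (\<lambda>\<omega>. 1 / P t \<omega> astar) \<le> W p0 + 1 / \<delta>" for t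
  proof -
    have "expectation (\<lambda>\<omega>. 1 / P t \<omega> astar) \<le> expectation (\<lambda>\<omega>. W (P t \<omega>) + 1 / \<delta>)"
    proof (rule integral_mono_AE)
      show "AE \<omega> in M. 1 / P t \<omega> astar \<le> W (P t \<omega>) + 1 / \<delta>"
        using AE_P_in_open_simplex
      proof eventually_elim
        case (elim \<omega>)
        then have "P t \<omega> \<in> open_simplex" by simp
        then have "1 / \<delta> * P t \<omega> astar \<le> 1 / \<delta> * 1" using open_simplexD(2) \<delta> by (intro mult_left_mono) auto
        then show ?case unfolding W_def by linarith
      qed
    qed (use integrable_P[of "\<lambda>p. 1 / p astar" t] integrable_P[of "\<lambda>p. W p + 1 / \<delta>" t] in auto)
    also have "\<dots> = expectation (\<lambda>\<omega>. W (P t \<omega>)) + 1 / \<delta>" using integrable_P[of W t] by (simp add: prob_space)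
    finally show ?thesis using bound[of t] by simp
  qed
  then show ?thesis by blast
qed

text \<open>By Fatou the lower limit of the reciprocals has finite mean, so it is almost surely
  finite.\<close>

lemma AE_not_tendsto_0: "AE \<omega> in M. \<not> (\<lambda>t. P t \<omega> astar) \<longlonglongrightarrow> 0"
proof -
  obtain C where C: "\<And>t. expectation (\<lambda>\<omega>. 1 / P t \<omega> astar) \<le> C"
    using expectation_inverse_best_bounded by auto
  let ?y = "\<lambda>t \<omega>. ennreal (1 / P t \<omega> astar)"
  have [measurable]: "?y t \<in> borel_measurable M" for t
    using borel_measurable_P[of "\<lambda>p. 1 / p astar" t] by measurable
  have "(\<integral>\<^sup>+\<omega>. ?y t \<omega> \<partial>M) \<le> ennreal C" for t
  proof -
    have "(\<integral>\<^sup>+\<omega>. ?y t \<omega> \<partial>M) = ennreal (expectation (\<lambda>\<omega>. 1 / P t \<omega> astar))"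
      using AE_P_in_open_simplex integrable_P[of "\<lambda>p. 1 / p astar" t]
      by (intro nn_integral_eq_integral) (auto elim!: eventually_mono simp: open_simplexD(1) less_imp_le)
    then show ?thesis using C[of t] by (simp add: ennreal_leI)
  qed
  then have "limsup (\<lambda>t. \<integral>\<^sup>+\<omega>. ?y t \<omega> \<partial>M) \<le> ennreal C" by (intro Limsup_bounded) auto
  then have "liminf (\<lambda>t. \<integral>\<^sup>+\<omega>. ?y t \<omega> \<partial>M) \<le> ennreal C"
    using Liminf_le_Limsup[of sequentially "\<lambda>t. \<integral>\<^sup>+\<omega>. ?y t \<omega> \<partial>M"] by auto
  then have "(\<integral>\<^sup>+\<omega>. liminf (\<lambda>t. ?y t \<omega>) \<partial>M) \<le> ennreal C"
    using nn_integral_liminf[of ?y M] by (auto intro: order_trans)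
  then have "AE \<omega> in M. liminf (\<lambda>t. ?y t \<omega>) \<noteq> \<infinity>"
    by (intro nn_integral_PInf_AE) (auto simp: top_unique)
  then show ?thesis using AE_P_in_open_simplex
  proof eventually_elim
    case (elim \<omega>)
    show ?case
    proof
      assume "(\<lambda>t. P t \<omega> astar) \<longlonglongrightarrow> 0"
      moreover have "eventually (\<lambda>t. 0 < P t \<omega> astar) sequentially" using elim(2) by (simp add: open_simplexD(1))
      ultimately have "LIM t sequentially. 1 / P t \<omega> astar :> at_top"
        using filterlim_inverse_at_top[of "\<lambda>t. P t \<omega> astar" sequentially]
        by (simp add: inverse_eq_divide)
      then have "(\<lambda>t. ?y t \<omega>) \<longlonglongrightarrow> \<infinity>" by (simp add: ennreal_tendsto_top_eq_at_top)
      then have "liminf (\<lambda>t. ?y t \<omega>) = \<infinity>" by (intro lim_imp_Liminf) auto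
      then show False using elim(1) by simp
    qed
  qed
qed

theorem AE_tendsto_1: "AE \<omega> in M. (\<lambda>t. P t \<omega> astar) \<longlonglongrightarrow> 1"
proof -
  \<comment> \<open>Radii 1 / (n + 1) keep the union of exceptional null sets countable.\<close>
  have "AE \<omega> in M. \<forall>n::nat. eventually (\<lambda>t. P t \<omega> astar < 1 / real (Suc n) \<or>
      1 - P t \<omega> astar < real CARD('a) * (1 / real (Suc n))) sequentially"
    by (subst AE_all_countable, intro allI AE_trapped) auto
  then show ?thesis using AE_not_tendsto_0 AE_Tie
  proof eventually_elim
    case (elim \<omega>)
    have p: "P t \<omega> \<in> open_simplex" for t using elim(3) by (intro P_in_open_simplex) auto
    have s: "leader (P t \<omega>) (X (Tie t) \<omega>) \<in> leaders (P t \<omega>)" for t using elim(3) by (intro leader_in_leaders) auto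
    show ?case
    proof (rule tendsto_1_if_trapped[where N = "real CARD('a)"])
      show "1 \<le> real CARD('a)" using card by simp
      show "0 < P t \<omega> astar" for t using open_simplexD(1)[OF p] .
      show "P (Suc t) \<omega> astar \<le> real CARD('a) * P t \<omega> astar" for t
      proof -
        have "1 * P t \<omega> astar \<le> real CARD('a) * P t \<omega> astar"
          using open_simplexD(1)[OF p, of t astar] card by (intro mult_right_mono) auto
        then show ?thesis
          using P_Suc[OF refl p refl refl, of t] play_le_card_mult[OF \<beta> p s card] by simp
      qed
      show "P t \<omega> astar < 1" for t
      proof -
        obtain b :: 'a where b: "b \<noteq> astar" using other_arm by auto
        have "P t \<omega> astar + P t \<omega> b = sum (P t \<omega>) {astar, b}" using b by simp
        also have "\<dots> \<le> sum (P t \<omega>) UNIV"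
          using less_imp_le[OF open_simplexD(1)[OF p]] by (intro sum_mono2) auto
        finally show ?thesis using open_simplexD(3)[OF p] open_simplexD(1)[OF p, of t b] by simp
      qed
      show "\<not> (\<lambda>t. P t \<omega> astar) \<longlonglongrightarrow> 0" by (rule elim(2))
      show "eventually (\<lambda>t. P t \<omega> astar < \<epsilon> \<or> 1 - P t \<omega> astar < real CARD('a) * \<epsilon>) sequentially" if \<epsilon>: "0 < \<epsilon>" for \<epsilon>
      proof -
        obtain n where n: "1 / real (Suc n) < \<epsilon>" using nat_approx_posE[OF \<epsilon>] .
        then have "real CARD('a) * (1 / real (Suc n)) \<le> real CARD('a) * \<epsilon>" by (intro mult_left_mono) auto
        moreover have "eventually (\<lambda>t. P t \<omega> astar < 1 / real (Suc n) \<or>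
           1 - P t \<omega> astar < real CARD('a) * (1 / real (Suc n))) sequentially" using elim(1) by blast
        ultimately show ?thesis using n by (auto elim!: eventually_mono)
      qed
    qed
  qed
qed

end

section \<open>Regret\<close>

context samba
begin

lemma expectation_inverse_le:
  assumes K: "6 * real CARD('a) \<le> K"
  shows "expectation (\<lambda>\<omega>. max (1 / P t \<omega> a) K) \<le> max (1 / p0 a) K + real t"
proof (induction t)
  case 0
  then show ?case by (simp add: prob_space)
next
  case (Suc t)
  have "expectation (\<lambda>\<omega>. max (1 / P (Suc t) \<omega> a) K) \<le> expectation (\<lambda>\<omega>. max (1 / P t \<omega> a) K) + expectation (\<lambda>\<omega>. 1)"
    using drift_inverse_le_1[where r = r and a = a, OF \<beta> _ _ r K]
    by (intro expectation_drift_le[of "\<lambda>p. max (1 / p a) K" "\<lambda>_. 1"])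
  then show ?case using Suc by (simp add: prob_space)
qed

text \<open>Jensen for the concave function J (ln y), by its tangent at \<open>m\<close>. The slope
  is nonnegative and the mean of the truncated reciprocal is at most \<open>m\<close>, so the linear
  term drops out.\<close>

lemma expectation_potential_ge:
  assumes K: "K = 6 * real CARD('a)" and T: "1 \<le> T"
  shows "potential \<beta> (p0 a) - expectation (\<lambda>\<omega>. potential \<beta> (P T \<omega> a)) \<le> J (ln (K + real T)) / \<beta>"
proof -
  define y m where "y = 1 / p0 a" and "m = max y K + real T"
  have K1: "1 \<le> K" using card K by simp
  have y: "1 \<le> y" using open_simplexD(1,2)[OF p0, of a] by (simp add: y_def)
  have m: "1 \<le> m" using K1 by (simp add: m_def)
  define c where "c = ln (exp 1 + ln m) / m"
  have c: "0 \<le> c" using m ln_e_plus_ge_1[of "ln m"] by (simp add: c_def)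
  let ?Y = "\<lambda>\<omega>. max (1 / P T \<omega> a) K"
  have "expectation (\<lambda>\<omega>. J (- ln (P T \<omega> a))) \<le> expectation (\<lambda>\<omega>. J (ln m) + c * (?Y \<omega> - m))"
  proof (rule integral_mono_AE)
    show "AE \<omega> in M. J (- ln (P T \<omega> a)) \<le> J (ln m) + c * (?Y \<omega> - m)"
      using AE_P_in_open_simplex
    proof eventually_elim
      case (elim \<omega>)
      then have "P T \<omega> \<in> open_simplex" by simp
      then have p: "0 < P T \<omega> a" "P T \<omega> a \<le> 1" by (simp_all add: open_simplexD(1,2))
      have "J (- ln (P T \<omega> a)) = J (ln (1 / P T \<omega> a))" using p by (simp add: ln_div)
      also have "\<dots> \<le> J (ln (?Y \<omega>))" using p K1 by (intro J_mono ln_mono) auto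
      also have "\<dots> \<le> J (ln m) + c * (?Y \<omega> - m)" unfolding c_def using m K1 by (intro J_ln_tangent) auto
      finally show ?case .
    qed
  qed (use integrable_P[of "\<lambda>p. J (- ln (p a))" T] integrable_P[of "\<lambda>p. J (ln m) + c * (max (1 / p a) K - m)" T] in auto)
  also have "\<dots> = J (ln m) + c * (expectation ?Y - m)"
    using integrable_P[of "\<lambda>p. max (1 / p a) K" T] by (simp add: prob_space)
  also have "\<dots> \<le> J (ln m)"
    using c expectation_inverse_le[of K T a] K by (simp add: m_def y_def mult_nonneg_nonpos)
  finally have E: "expectation (\<lambda>\<omega>. J (- ln (P T \<omega> a))) \<le> J (ln m)" .
  \<comment> \<open>A start above \<open>K\<close> is moved down to \<open>K\<close> by decreasing
    increments; the result is free of the initial state.\<close>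
  have "J (ln m) - J (ln y) \<le> J (ln (K + real T))"
  proof (cases "K \<le> y")
    case True
    then have "J (ln m) - J (ln y) \<le> J (ln (K + real T)) - J (ln K)"
      using J_ln_increment_antimono[OF K1 True, of "real T"] by (simp add: m_def)
    then show ?thesis using J_nonneg[of "ln K"] K1 by simp
  next
    case False
    then show ?thesis using J_nonneg[of "ln y"] y by (simp add: m_def)
  qed
  moreover have "J (ln y) = J (- ln (p0 a))" using open_simplexD(1)[OF p0, of a] by (simp add: y_def ln_div)
  ultimately have "expectation (\<lambda>\<omega>. J (- ln (P T \<omega> a))) - J (- ln (p0 a)) \<le> J (ln (K + real T))" using E by simp
  then have "(expectation (\<lambda>\<omega>. J (- ln (P T \<omega> a))) - J (- ln (p0 a))) / \<beta> \<le> J (ln (K + real T)) / \<beta>"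
    using \<beta> by (intro divide_right_mono) auto
  then show ?thesis by (simp add: potential_def diff_divide_distrib)
qed

lemma has_bochner_integral_reward:
  "has_bochner_integral M (\<lambda>\<omega>. \<Sum>a\<in>UNIV. (if pick (P t \<omega>) (X (Sel t) \<omega>) = a then 1 else 0) * X (Rew a t) \<omega>)
    (expectation (\<lambda>\<omega>. \<Sum>a\<in>UNIV. P t \<omega> a * r a))"
proof -
  \<comment> \<open>The tie is unconstrained here; \<open>UNIV\<close> brings the event into the
    form of \<open>past_event_indep\<close>.\<close>
  define F where "F = (\<lambda>x a. {\<omega>\<in>space M. P t \<omega> = x} \<inter> (X (Tie t) -` UNIV \<inter> space M)
    \<inter> (X (Sel t) -` {u. pick x u = a} \<inter> space M) \<inter> (X (Rew a t) -` {1} \<inter> space M))"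
  have F_sets: "F x a \<in> sets M" for x a
    unfolding F_def by (intro sets.Int measurable_sets[OF X_measurable] pick_sets P_sets) auto
  have F_prob: "prob (F x a) = prob {\<omega>\<in>space M. P t \<omega> = x} * (x a * r a)" for x a
  proof (cases "x \<in> open_simplex")
    case True
    have "prob (X (Rew a t) -` {1} \<inter> space M) = r a"
      using Rew[of a t] by (simp add: vimage_def Int_def conj_commute)
    moreover have "measure unif UNIV = 1" using prob_space.prob_space[OF prob_space_unif] by simp
    ultimately show ?thesis unfolding F_def
      by (subst past_event_indep[OF past_event_P]) (auto simp: measure_pick[OF True])
  next
    case False
    have "prob (F x a) \<le> prob {\<omega>\<in>space M. P t \<omega> = x}" by (intro finite_measure_mono) (auto simp: F_def)
    then show ?thesis using prob_P_eq_0[OF False] measure_nonneg[of M "F x a"] by simp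
  qed
  have "has_bochner_integral M (\<lambda>\<omega>. \<Sum>x\<in>states t. \<Sum>a\<in>UNIV. indicat_real (F x a) \<omega>)
      (\<Sum>x\<in>states t. \<Sum>a\<in>UNIV. prob (F x a))"
    by (intro has_bochner_integral_sum has_bochner_integral_real_indicator F_sets) (auto simp: less_top[symmetric])
  moreover have "(\<Sum>x\<in>states t. \<Sum>a\<in>UNIV. prob (F x a)) = expectation (\<lambda>\<omega>. \<Sum>a\<in>UNIV. P t \<omega> a * r a)"
    unfolding expectation_P[of "\<lambda>p. \<Sum>a\<in>UNIV. p a * r a"] F_prob by (simp add: sum_distrib_left)
  moreover have "(\<Sum>x\<in>states t. \<Sum>a\<in>UNIV. indicat_real (F x a) \<omega>)
      = (\<Sum>a\<in>UNIV. (if pick (P t \<omega>) (X (Sel t) \<omega>) = a then 1 else 0) * X (Rew a t) \<omega>)"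
    if \<omega>: "\<omega> \<in> space M" for \<omega>
  proof -
    have "indicat_real (F x a) \<omega> = indicat_real {\<omega>. P t \<omega> = x} \<omega> *
        ((if pick x (X (Sel t) \<omega>) = a then 1 else 0) * X (Rew a t) \<omega>)" for x a
      using Rew_01[of a t \<omega>] \<omega> by (auto simp: F_def indicator_def)
    then show ?thesis
      unfolding sum_over_states[of "\<lambda>x \<omega>. \<Sum>a\<in>UNIV. (if pick x (X (Sel t) \<omega>) = a then 1 else 0) * X (Rew a t) \<omega>" t \<omega>]
      by (simp only: sum_distrib_left)
  qed
  ultimately show ?thesis by (subst has_bochner_integral_cong[OF refl _ refl]) auto
qed

lemma samba_regret_eq:
  "samba_regret M X (r astar) P T = (\<Sum>t<T. r astar - expectation (\<lambda>\<omega>. \<Sum>a\<in>UNIV. P t \<omega> a * r a))"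
proof -
  have "has_bochner_integral M
      (\<lambda>\<omega>. \<Sum>t<T. \<Sum>a\<in>UNIV. (if pick (P t \<omega>) (X (Sel t) \<omega>) = a then 1 else 0) * X (Rew a t) \<omega>)
      (\<Sum>t<T. expectation (\<lambda>\<omega>. \<Sum>a\<in>UNIV. P t \<omega> a * r a))"
    by (intro has_bochner_integral_sum has_bochner_integral_reward)
  then show ?thesis
    unfolding samba_regret_def by (subst has_bochner_integral_integral_eq) (auto simp: sum_subtractf mult.commute)
qed

lemma samba_regret_le_horizon: "samba_regret M X (r astar) P T \<le> real T"
proof -
  have "0 \<le> expectation (\<lambda>\<omega>. \<Sum>a\<in>UNIV. P t \<omega> a * r a)" for t
    using AE_P_in_open_simplex
    by (intro integral_nonneg_AE) (auto elim!: eventually_mono intro!: sum_nonneg mult_nonneg_nonneg r(1) simp: open_simplexD(1) less_imp_le)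
  then have "samba_regret M X (r astar) P T \<le> (\<Sum>t<T. 1)"
    unfolding samba_regret_eq using r(2)[of astar] by (intro sum_mono) (smt (verit))
  then show ?thesis by simp
qed

text \<open>The drift inequality telescopes. If another arm leads, the best arm has at most 1/2, so
  the extra 1 is charged to that event.\<close>

lemma samba_regret_le_potential:
  "samba_regret M X (r astar) P T \<le>
    (\<Sum>a\<in>UNIV-{astar}. potential \<beta> (p0 a) - expectation (\<lambda>\<omega>. potential \<beta> (P T \<omega> a)))
    + (\<Sum>t<T. prob {\<omega>\<in>space M. P t \<omega> astar \<le> 1/2})"
proof -
  let ?V = "\<lambda>p :: 'a \<Rightarrow> real. \<Sum>a\<in>UNIV - {astar}. potential \<beta> (p a)"
  let ?bad = "\<lambda>p :: 'a \<Rightarrow> real. indicat_real {p. p astar \<le> 1/2} p"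
  let ?gain = "\<lambda>p :: 'a \<Rightarrow> real. \<Sum>a\<in>UNIV. p a * r a"
  have bad: "expectation (\<lambda>\<omega>. ?bad (P t \<omega>)) = prob {\<omega>\<in>space M. P t \<omega> astar \<le> 1/2}" for t
  proof -
    have "expectation (\<lambda>\<omega>. ?bad (P t \<omega>)) = expectation (indicat_real {\<omega>\<in>space M. P t \<omega> astar \<le> 1/2})"
      by (intro Bochner_Integration.integral_cong) (auto simp: indicator_def)
    then show ?thesis using borel_measurable_P[of "\<lambda>p. p astar" t] by simp
  qed
  have "r astar - expectation (\<lambda>\<omega>. ?gain (P t \<omega>)) \<le>
      expectation (\<lambda>\<omega>. ?V (P t \<omega>)) - expectation (\<lambda>\<omega>. ?V (P (Suc t) \<omega>)) + prob {\<omega>\<in>space M. P t \<omega> astar \<le> 1/2}" for t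
  proof -
    have "expectation (\<lambda>\<omega>. ?V (P (Suc t) \<omega>)) \<le> expectation (\<lambda>\<omega>. ?V (P t \<omega>))
        + expectation (\<lambda>\<omega>. ?bad (P t \<omega>) - (r astar - ?gain (P t \<omega>)))"
    proof (rule expectation_drift_le[of ?V "\<lambda>p. ?bad p - (r astar - ?gain p)"])
      fix p :: "'a \<Rightarrow> real" and s assume p: "p \<in> open_simplex" and s: "s \<in> leaders p"
      show "drift \<beta> r ?V p s \<le> ?bad p - (r astar - ?gain p)"
        using drift_potential_le[where r = r and c = astar, OF \<beta> p s r r_le_best]
          not_leader_le_half[OF p s, of astar] by (cases "s = astar") (auto simp: indicator_def)
    qed
    also have "expectation (\<lambda>\<omega>. ?bad (P t \<omega>) - (r astar - ?gain (P t \<omega>)))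
        = prob {\<omega>\<in>space M. P t \<omega> astar \<le> 1/2} - (r astar - expectation (\<lambda>\<omega>. ?gain (P t \<omega>)))"
      using integrable_P[of ?bad t] integrable_P[of ?gain t] integrable_P[of "\<lambda>p. r astar - ?gain p" t]
      by (simp only: Bochner_Integration.integral_diff bad) (simp add: prob_space)
    finally show ?thesis by simp
  qed
  then have "samba_regret M X (r astar) P T \<le> (\<Sum>t<T. expectation (\<lambda>\<omega>. ?V (P t \<omega>)) - expectation (\<lambda>\<omega>. ?V (P (Suc t) \<omega>))
      + prob {\<omega>\<in>space M. P t \<omega> astar \<le> 1/2})"
    unfolding samba_regret_eq by (intro sum_mono)
  also have "\<dots> = expectation (\<lambda>\<omega>. ?V (P 0 \<omega>)) - expectation (\<lambda>\<omega>. ?V (P T \<omega>)) + (\<Sum>t<T. prob {\<omega>\<in>space M. P t \<omega> astar \<le> 1/2})"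
    using sum_lessThan_telescope'[of "\<lambda>t. expectation (\<lambda>\<omega>. ?V (P t \<omega>))" T] by (simp only: sum.distrib)
  also have "expectation (\<lambda>\<omega>. ?V (P 0 \<omega>)) = ?V p0" by (simp add: prob_space)
  also have "expectation (\<lambda>\<omega>. ?V (P T \<omega>)) = (\<Sum>a\<in>UNIV-{astar}. expectation (\<lambda>\<omega>. potential \<beta> (P T \<omega> a)))"
    using integrable_P[of "\<lambda>p. potential \<beta> (p _)" T] by (intro Bochner_Integration.integral_sum)
  finally show ?thesis by (simp add: sum_subtractf)
qed

text \<open>Long horizons use the potential; otherwise the regret is at most T, which is at most N
  loglog T + 1.\<close>

theorem regret_bound:
  assumes T: "1 \<le> T"
  shows "samba_regret M X (r astar) P T \<le> real CARD('a) / (\<beta> * gap) * ln (real T) * ln (exp 1 + ln (real T))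
    + (\<Sum>t<T. prob {\<omega>\<in>space M. P t \<omega> astar \<le> 1/2}) + 1"
proof -
  let ?N = "CARD('a)" and ?A = "loglog (real T)"
  have bad: "0 \<le> (\<Sum>t<T. prob {\<omega>\<in>space M. P t \<omega> astar \<le> 1/2})" by (intro sum_nonneg) auto
  have A: "0 \<le> ?A" using T by (intro loglog_nonneg) auto
  obtain b :: 'a where b: "b \<noteq> astar" using other_arm by auto
  \<comment> \<open>Both cases give a bound without the gap; since \<open>gap \<le> 1\<close>,
    dividing by it only enlarges the bound.\<close>
  have gap1: "gap \<le> 1" using gap[OF b] r[of astar] r[of b] by linarith
  have "\<beta> * gap \<le> \<beta> * 1" using \<beta> gap1 by (intro mult_left_mono) auto
  then have "real ?N * ?A / \<beta> \<le> real ?N * ?A / (\<beta> * gap)"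
    using A \<beta> gap_pos by (intro divide_left_mono) auto
  then have le: "real ?N * ?A / \<beta> \<le> real ?N / (\<beta> * gap) * ln (real T) * ln (exp 1 + ln (real T))"
    by (simp add: mult_ac)
  show ?thesis
  proof (cases "real ?N * ?A + 1 < real T")
    case True
    have "samba_regret M X (r astar) P T \<le> (\<Sum>a\<in>UNIV-{astar}. J (ln (6 * real ?N + real T)) / \<beta>)
        + (\<Sum>t<T. prob {\<omega>\<in>space M. P t \<omega> astar \<le> 1/2})"
      by (rule order_trans[OF samba_regret_le_potential] add_right_mono sum_mono expectation_potential_ge refl T)+
    also have "(\<Sum>a\<in>UNIV-{astar}. J (ln (6 * real ?N + real T)) / \<beta>)
        = real (?N - 1) * J (ln (6 * real ?N + real T)) / \<beta>" by simp
    also have "\<dots> \<le> real ?N * ?A / \<beta>"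
      using horizon_dichotomy[OF card T True] \<beta> by (intro divide_right_mono) auto
    finally show ?thesis using le by linarith
  next
    case False
    have "real ?N * ?A * \<beta> \<le> real ?N * ?A * 1" using A \<beta> by (intro mult_left_mono) auto
    then have "real ?N * ?A \<le> real ?N * ?A / \<beta>" using \<beta> by (simp add: pos_le_divide_eq)
    then show ?thesis using False samba_regret_le_horizon[of T] le bad by linarith
  qed
qed

text \<open>In \<open>ennreal\<close> the full series makes sense whether or not it converges, and
  it dominates its partial sums.\<close>

theorem regret_bound_ennreal:
  assumes T: "1 \<le> T"
  shows "ennreal (samba_regret M X (r astar) P T)
    \<le> ennreal (real CARD('a) / (\<beta> * gap) * ln (real T) * ln (exp 1 + ln (real T)))
      + (\<Sum>t. emeasure M {\<omega>\<in>space M. P t \<omega> astar \<le> 1/2}) + 1"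
proof -
  let ?B = "real CARD('a) / (\<beta> * gap) * ln (real T) * ln (exp 1 + ln (real T))"
  let ?p = "\<lambda>t. {\<omega>\<in>space M. P t \<omega> astar \<le> 1/2}"
  have B: "0 \<le> ?B"
    using T \<beta> gap_pos ln_e_plus_ge_1[of "ln (real T)"] by (intro mult_nonneg_nonneg divide_nonneg_nonneg) auto
  have "ennreal (samba_regret M X (r astar) P T) \<le> ennreal (?B + (\<Sum>t<T. prob (?p t)) + 1)"
    by (intro ennreal_leI regret_bound T)
  also have "\<dots> = ennreal ?B + (\<Sum>t<T. emeasure M (?p t)) + 1"
    using B by (simp add: ennreal_plus sum_nonneg emeasure_eq_measure flip: sum_ennreal)
  also have "\<dots> \<le> ennreal ?B + (\<Sum>t. emeasure M (?p t)) + 1"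
    by (intro add_mono sum_le_suminf) auto
  finally show ?thesis .
qed

end

theorem theorem3:
  fixes M :: "'w measure"
    and X :: "'a::{finite,linorder} noise \<Rightarrow> 'w \<Rightarrow> real"
    and r :: "'a \<Rightarrow> real" and astar :: 'a and p0 :: "'a \<Rightarrow> real" and \<beta> :: real
  assumes "prob_space M"
    and "CARD('a) \<ge> 2"
    and "\<forall>a. 0 \<le> r a \<and> r a \<le> 1"
    and "\<forall>a. a \<noteq> astar \<longrightarrow> r a < r astar"
    and "\<forall>a. 0 < p0 a" and "(\<Sum>a\<in>UNIV. p0 a) = 1"
    and "0 < \<beta>" and "\<beta> \<le> 1"
    and "prob_space.indep_vars M (\<lambda>_. borel) X UNIV"
    and "\<forall>a t \<omega>. X (Rew a t) \<omega> \<in> {0, 1}"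
    and "\<forall>a t. measure M {\<omega>\<in>space M. X (Rew a t) \<omega> = 1} = r a"
    and "\<forall>t. distr M borel (X (Sel t)) = uniform_measure lborel {0..1}"
    and "\<forall>t. distr M borel (X (Tie t)) = uniform_measure lborel {0..1}"
  defines "P \<equiv> samba_proc (samba_alpha \<beta>) p0 X"
    and "\<Delta> \<equiv> r astar - Max (r ` (UNIV - {astar}))"
    and "Q \<equiv> (\<Sum>t. emeasure M {\<omega>\<in>space M. samba_proc (samba_alpha \<beta>) p0 X t \<omega> astar \<le> 1/2})"
  shows "discrete_markov_chain M P
    \<and> (AE \<omega> in M. (\<lambda>t. P t \<omega> astar) \<longlonglongrightarrow> 1)
    \<and> (\<forall>T::nat. T \<ge> 1 \<longrightarrow>
         ennreal (samba_regret M X (r astar) P T)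
           \<le> ennreal (real CARD('a) / (\<beta> * \<Delta>) * ln (real T) * ln (exp 1 + ln (real T))) + Q + 1)"
proof -
  interpret prob_space M by fact
  interpret samba M X r astar p0 \<beta>
    by unfold_locales (use assms in \<open>auto simp: open_simplex_def\<close>)
  show ?thesis
    unfolding P_def \<Delta>_def Q_def
    using markov AE_tendsto_1 regret_bound_ennreal unfolding gap_def by blast
qed

end
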